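(* Let $\Sigma$ be a locally finite relational signature, $\mathbf{K}$ a local class of $\Sigma$-structures with Fra\"iss\'e limit $F$, and $\mu_\infty$ the frame-wise uniform measure on $\mathbf{K}^\infty$. Then $\mu_\infty(\{S\in\mathbf{K}^\infty : S\cong F\})=1$.
   Context: A relational signature is locally finite if it has finitely many $n$-ary relation symbols for each $n$. For a structure $M$, $|M|$ is its underlying set. General Irreflexivity axioms: for every $R\in\Sigma$ of arity $n\ge2$ and distinct $i,j$, $\forall\bar x\,(R(x_1,\dots,x_n)\to x_i\ne x_j)$. A local sentence has the form $\forall x_1\cdots\forall x_m(R(x_1,\dots,x_m)\to\psi)$, $m>0$, $R\in\Sigma$ of arity $m$, $\psi$ quantifier-free. A local class is $\mathbf{K}=\mathrm{Mod}\,\Phi$, the class of finite $\Sigma$-structures with underlying set a subset of $\mathbb{N}$ satisfying a set $\Phi$ of local sentences containing all General Irreflexivity axioms. The $n$-frame $A^{(n)}$ of $A$ ($n\ge0$) keeps the underlying set and the relations of arity $\le n$ and interprets all higher-arity relations as empty. $A\restriction X$ is the induced substructure on $X$. The Fra\"iss\'e limit $F$ is the unique up to isomorphism countable $\Sigma$-structure whose finite substructures are, up to isomorphism, exactly $\mathbf{K}$, and which is weakly homogeneous (for finite $B$ embeddable in $F$, substructure $A\subseteq B$ and embedding $f:A\to F$, some embedding $B\to F$ extends $f$). $\mathbf{K}^\infty$ is the set of $\Sigma$-structures with underlying set $\mathbb{N}$ satisfying $\Phi$. For $A\in\mathbf{K}$ and $k\in\mathbb{N}$ let $O_\infty(A,k)=\{S\in\mathbf{K}^\infty:(S\restriction|A|)^{(k)}=A^{(k)}\}$;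 these sets form a base of a compact topology on $\mathbf{K}^\infty$. For $S\in\mathbf{K}$, $N(S,k)$ is the number of distinct $(k+1)$-frames of structures $T\in\mathbf{K}$ with $|T|=|S|$ and $T^{(k)}=S^{(k)}$. Setting $\mu_\infty(O_\infty(A,0))=1$ and $\mu_\infty(O_\infty(A,k+1))=\mu_\infty(O_\infty(A,k))/N(A,k)$ defines a finitely additive function on the ring generated by these clopen sets, which extends (Carath\'eodory) to a probability measure $\mu_\infty$ on the generated $\sigma$-algebra, the frame-wise uniform measure. *)

theory Defs
  imports "HOL-Analysis.Analysis"
begin

record 'r signature =
  syms :: "'r set"
  arity :: "'r \<Rightarrow> nat"

definition locally_finite :: "'r signature \<Rightarrow> bool" where
  "locally_finite \<Sigma> \<longleftrightarrow> (\<forall>n. finite {R \<in> syms \<Sigma>. arity \<Sigma> R = n})"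

datatype ('a, 'r) struct = Struct (universe: "'a set") (rel: "'r \<Rightarrow> 'a list set")

text \<open>Symbols outside the signature are interpreted as empty, so that equality of the HOL values
  is equality of \<open>\<Sigma>\<close>-structures. The empty structure is allowed.\<close>

definition is_structure :: "'r signature \<Rightarrow> ('a, 'r) struct \<Rightarrow> bool" where
  "is_structure \<Sigma> A \<longleftrightarrow>
     (\<forall>R \<in> syms \<Sigma>. rel A R \<subseteq> {xs \<in> lists (universe A). length xs = arity \<Sigma> R}) \<and>
     (\<forall>R. R \<notin> syms \<Sigma> \<longrightarrow> rel A R = {})"

definition restr :: "('a, 'r) struct \<Rightarrow> 'a set \<Rightarrow> ('a, 'r) struct" where
  "restr A X = Struct (universe A \<inter> X) (\<lambda>R. rel A R \<inter> lists X)"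

definition frame :: "'r signature \<Rightarrow> nat \<Rightarrow> ('a, 'r) struct \<Rightarrow> ('a, 'r) struct" where
  "frame \<Sigma> n A = Struct (universe A) (\<lambda>R. if arity \<Sigma> R \<le> n then rel A R else {})"

definition embedding ::
  "'r signature \<Rightarrow> ('a \<Rightarrow> 'b) \<Rightarrow> ('a, 'r) struct \<Rightarrow> ('b, 'r) struct \<Rightarrow> bool" where
  "embedding \<Sigma> f A B \<longleftrightarrow>
     f ` universe A \<subseteq> universe B \<and> inj_on f (universe A) \<and>
     (\<forall>R \<in> syms \<Sigma>. \<forall>xs \<in> lists (universe A). length xs = arity \<Sigma> R \<longrightarrow>
        (xs \<in> rel A R \<longleftrightarrow> map f xs \<in> rel B R))"

definition isomorphic :: "'r signature \<Rightarrow> ('a, 'r) struct \<Rightarrow> ('b, 'r) struct \<Rightarrow> bool" where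
  "isomorphic \<Sigma> A B \<longleftrightarrow> (\<exists>f. embedding \<Sigma> f A B \<and> f ` universe A = universe B)"

datatype 'r qf =
    Falsum
  | Eq nat nat
  | Atom 'r "nat list"
  | Neg "'r qf"
  | Conj "'r qf" "'r qf"
  | Disj "'r qf" "'r qf"
  | Imp "'r qf" "'r qf"

primrec wf_qf :: "'r signature \<Rightarrow> nat \<Rightarrow> 'r qf \<Rightarrow> bool" where
  "wf_qf \<Sigma> m Falsum \<longleftrightarrow> True"
| "wf_qf \<Sigma> m (Eq i j) \<longleftrightarrow> i < m \<and> j < m"
| "wf_qf \<Sigma> m (Atom R is) \<longleftrightarrow> R \<in> syms \<Sigma> \<and> length is = arity \<Sigma> R \<and> (\<forall>i \<in> set is. i < m)"
| "wf_qf \<Sigma> m (Neg p) \<longleftrightarrow> wf_qf \<Sigma> m p"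
| "wf_qf \<Sigma> m (Conj p q) \<longleftrightarrow> wf_qf \<Sigma> m p \<and> wf_qf \<Sigma> m q"
| "wf_qf \<Sigma> m (Disj p q) \<longleftrightarrow> wf_qf \<Sigma> m p \<and> wf_qf \<Sigma> m q"
| "wf_qf \<Sigma> m (Imp p q) \<longleftrightarrow> wf_qf \<Sigma> m p \<and> wf_qf \<Sigma> m q"

primrec sat_qf :: "('a, 'r) struct \<Rightarrow> (nat \<Rightarrow> 'a) \<Rightarrow> 'r qf \<Rightarrow> bool" where
  "sat_qf A v Falsum \<longleftrightarrow> False"
| "sat_qf A v (Eq i j) \<longleftrightarrow> v i = v j"
| "sat_qf A v (Atom R is) \<longleftrightarrow> map v is \<in> rel A R"
| "sat_qf A v (Neg p) \<longleftrightarrow> \<not> sat_qf A v p"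
| "sat_qf A v (Conj p q) \<longleftrightarrow> sat_qf A v p \<and> sat_qf A v q"
| "sat_qf A v (Disj p q) \<longleftrightarrow> sat_qf A v p \<or> sat_qf A v q"
| "sat_qf A v (Imp p q) \<longleftrightarrow> (sat_qf A v p \<longrightarrow> sat_qf A v q)"

text \<open>\<open>Local R \<psi>\<close> stands for the sentence
  \<open>\<forall>x\<^sub>0 \<dots> \<forall>x\<^bsub>m - 1\<^esub>. R (x\<^sub>0, \<dots>, x\<^bsub>m - 1\<^esub>) \<longrightarrow> \<psi>\<close>, where \<open>m\<close> is the arity of \<open>R\<close>.\<close>

datatype 'r local_sentence = Local 'r "'r qf"

primrec wf_local :: "'r signature \<Rightarrow> 'r local_sentence \<Rightarrow> bool" where
  "wf_local \<Sigma> (Local R \<psi>) \<longleftrightarrow> R \<in> syms \<Sigma> \<and> arity \<Sigma> R > 0 \<and> wf_qf \<Sigma> (arity \<Sigma> R) \<psi>"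

primrec sat_local :: "'r signature \<Rightarrow> ('a, 'r) struct \<Rightarrow> 'r local_sentence \<Rightarrow> bool" where
  "sat_local \<Sigma> A (Local R \<psi>) \<longleftrightarrow>
     (\<forall>xs \<in> lists (universe A). length xs = arity \<Sigma> R \<longrightarrow> xs \<in> rel A R \<longrightarrow> sat_qf A (\<lambda>i. xs ! i) \<psi>)"

definition general_irreflexivity :: "'r signature \<Rightarrow> 'r local_sentence set" where
  "general_irreflexivity \<Sigma> =
     {Local R (Neg (Eq i j)) | R i j.
        R \<in> syms \<Sigma> \<and> arity \<Sigma> R \<ge> 2 \<and> i < arity \<Sigma> R \<and> j < arity \<Sigma> R \<and> i \<noteq> j}"

definition local_axioms :: "'r signature \<Rightarrow> 'r local_sentence set \<Rightarrow> bool" where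
  "local_axioms \<Sigma> \<Phi> \<longleftrightarrow> (\<forall>\<phi> \<in> \<Phi>. wf_local \<Sigma> \<phi>) \<and> general_irreflexivity \<Sigma> \<subseteq> \<Phi>"

definition local_class :: "'r signature \<Rightarrow> 'r local_sentence set \<Rightarrow> (nat, 'r) struct set" where
  "local_class \<Sigma> \<Phi> =
     {A. is_structure \<Sigma> A \<and> finite (universe A) \<and> (\<forall>\<phi> \<in> \<Phi>. sat_local \<Sigma> A \<phi>)}"

definition local_class_inf :: "'r signature \<Rightarrow> 'r local_sentence set \<Rightarrow> (nat, 'r) struct set" where
  "local_class_inf \<Sigma> \<Phi> =
     {S. is_structure \<Sigma> S \<and> universe S = UNIV \<and> (\<forall>\<phi> \<in> \<Phi>. sat_local \<Sigma> S \<phi>)}"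

text \<open>The finite structure \<open>B\<close> ranges over structures on finite sets of natural numbers; up to
  isomorphism these are all finite structures. The substructures of \<open>B\<close> are the \<open>restr B X\<close> with
  \<open>X \<subseteq> universe B\<close>.\<close>

definition weakly_homogeneous :: "'r signature \<Rightarrow> ('a, 'r) struct \<Rightarrow> bool" where
  "weakly_homogeneous \<Sigma> F \<longleftrightarrow>
     (\<forall>(B :: (nat, 'r) struct) X f.
        is_structure \<Sigma> B \<longrightarrow> finite (universe B) \<longrightarrow> (\<exists>h. embedding \<Sigma> h B F) \<longrightarrow>
        X \<subseteq> universe B \<longrightarrow> embedding \<Sigma> f (restr B X) F \<longrightarrow>
        (\<exists>g. embedding \<Sigma> g B F \<and> (\<forall>x \<in> X. g x = f x)))"

definition fraisse_limit ::
  "'r signature \<Rightarrow> (nat, 'r) struct set \<Rightarrow> ('a, 'r) struct \<Rightarrow> bool" where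
  "fraisse_limit \<Sigma> K F \<longleftrightarrow>
     is_structure \<Sigma> F \<and> countable (universe F) \<and>
     (\<forall>X. X \<subseteq> universe F \<longrightarrow> finite X \<longrightarrow> (\<exists>A \<in> K. isomorphic \<Sigma> A (restr F X))) \<and>
     (\<forall>A \<in> K. \<exists>X. X \<subseteq> universe F \<and> finite X \<and> isomorphic \<Sigma> A (restr F X)) \<and>
     weakly_homogeneous \<Sigma> F"

definition O_inf ::
  "'r signature \<Rightarrow> 'r local_sentence set \<Rightarrow> (nat, 'r) struct \<Rightarrow> nat \<Rightarrow> (nat, 'r) struct set" where
  "O_inf \<Sigma> \<Phi> A k =
     {S \<in> local_class_inf \<Sigma> \<Phi>. frame \<Sigma> k (restr S (universe A)) = frame \<Sigma> k A}"

definition num_frames ::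
  "'r signature \<Rightarrow> 'r local_sentence set \<Rightarrow> (nat, 'r) struct \<Rightarrow> nat \<Rightarrow> nat" where
  "num_frames \<Sigma> \<Phi> S k =
     card {frame \<Sigma> (Suc k) T | T.
       T \<in> local_class \<Sigma> \<Phi> \<and> universe T = universe S \<and> frame \<Sigma> k T = frame \<Sigma> k S}"

primrec frame_weight ::
  "'r signature \<Rightarrow> 'r local_sentence set \<Rightarrow> (nat, 'r) struct \<Rightarrow> nat \<Rightarrow> real" where
  "frame_weight \<Sigma> \<Phi> A 0 = 1"
| "frame_weight \<Sigma> \<Phi> A (Suc k) = frame_weight \<Sigma> \<Phi> A k / real (num_frames \<Sigma> \<Phi> A k)"

text \<open>The measure on the \<open>\<sigma>\<close>-algebra generated by the sets \<open>O_inf \<Sigma> \<Phi> A k\<close> that takes the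
  prescribed values on them. (If no such measure existed, \<^const>\<open>extend_measure\<close> would be the zero
  measure.)\<close>

definition framewise_uniform_measure ::
  "'r signature \<Rightarrow> 'r local_sentence set \<Rightarrow> (nat, 'r) struct measure" where
  "framewise_uniform_measure \<Sigma> \<Phi> =
     extend_measure (local_class_inf \<Sigma> \<Phi>) (local_class \<Sigma> \<Phi> \<times> UNIV)
       (\<lambda>(A, k). O_inf \<Sigma> \<Phi> A k) (\<lambda>(A, k). ennreal (frame_weight \<Sigma> \<Phi> A k))"

end

theory Submission
  imports Defs "HOL-Probability.Probability"
begin

text \<open>By irreflexivity, a tuple in an \<open>n\<close>-ary relation lives on an \<open>n\<close>-element set, so a structure in the
  class is built by choosing, for every finite set \<open>X\<close> and independently, the relations of arity
  \<open>|X|\<close> on \<open>X\<close> among finitely many possibilities that depend only on the lower frame on \<open>X\<close>. Drawing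
  all these choices uniformly from an infinite product space gives a random structure whose law is the
  frame-wise uniform measure. Extending a finite substructure by a prescribed one-point extension
  realised at the point \<open>w\<close> is a condition on choices over sets containing \<open>w\<close>; for different \<open>w\<close> these
  conditions are independent, with probabilities bounded away from \<open>0\<close>, so almost surely one of them
  holds. The resulting extension property characterises the Fraisse limit by back and forth.\<close>

section \<open>Models of local sentences\<close>

text \<open>The range of the choice at X depends on earlier choices, so the choices cannot be
  indexed by sets alone. Instead there is one coordinate for every structure \<open>B\<close>,
  uniform on \<open>exts B\<close>, and \<open>sample\<close> reads at X only the coordinate named
  by the lower frame already built there. The factors are thus fixed in advance, and the event that
  the sample lies in \<open>O_inf \<Sigma> \<Phi> A k\<close> fixes finitely many coordinates, named
  by the lower frames of A itself. The same device removes conditioning from the extension argument: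
  the event for w prescribes the coordinates that are consulted if the sample agrees with the base
  structure, whether or not it does. Free choices are possible because a local sentence, at a tuple
  of its guarding relation, speaks only of the substructure on the entries of that tuple. The law of
  the sample also shows that a measure with the prescribed weights exists, so
  \<open>extend_measure\<close> does not collapse to zero. The isomorphism class of F is replaced by
  the extension property, a countable combination of basic sets; this yields measurability and
  leaves countably many almost sure statements.\<close>

lemma struct_eqI: "universe A = universe B \<Longrightarrow> (\<And>R. rel A R = rel B R) \<Longrightarrow> A = B"
  by (cases A; cases B) auto

lemma universe_restr [simp]: "universe (restr A X) = universe A \<inter> X"
  and rel_restr [simp]: "rel (restr A X) R = rel A R \<inter> lists X"
  and universe_frame [simp]: "universe (frame \<Sigma> k A) = universe A"
  and rel_frame [simp]: "rel (frame \<Sigma> k A) R = (if arity \<Sigma> R \<le> k then rel A R else {})"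
  by (simp_all add: restr_def frame_def)

lemma restr_restr: "Y \<subseteq> X \<Longrightarrow> restr (restr A X) Y = restr A Y"
  by (rule struct_eqI) auto

lemma is_structureD:
  assumes "is_structure \<Sigma> A" "xs \<in> rel A R"
  shows "R \<in> syms \<Sigma>" "length xs = arity \<Sigma> R" "set xs \<subseteq> universe A"
proof -
  show "R \<in> syms \<Sigma>" using assms by (auto simp: is_structure_def)
  then show "length xs = arity \<Sigma> R" "set xs \<subseteq> universe A"
    using assms by (auto simp: is_structure_def)
qed

lemma is_structureI:
  assumes "\<And>R xs. xs \<in> rel A R \<Longrightarrow> R \<in> syms \<Sigma> \<and> length xs = arity \<Sigma> R \<and> set xs \<subseteq> universe A"
  shows "is_structure \<Sigma> A"
  using assms unfolding is_structure_def by blast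

lemma is_structure_restr: "is_structure \<Sigma> A \<Longrightarrow> is_structure \<Sigma> (restr A X)"
  by (rule is_structureI) (auto dest: is_structureD)

lemma is_structure_frame: "is_structure \<Sigma> A \<Longrightarrow> is_structure \<Sigma> (frame \<Sigma> k A)"
  by (rule is_structureI) (auto dest: is_structureD split: if_splits)

lemma restr_universe: "is_structure \<Sigma> A \<Longrightarrow> universe A \<subseteq> X \<Longrightarrow> restr A X = A"
  by (rule struct_eqI) (auto dest: is_structureD)

lemma embeddingD:
  assumes "embedding \<Sigma> f A B"
  shows "f ` universe A \<subseteq> universe B" "inj_on f (universe A)"
    and "\<And>R xs. R \<in> syms \<Sigma> \<Longrightarrow> set xs \<subseteq> universe A \<Longrightarrow> length xs = arity \<Sigma> R \<Longrightarrow>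
           xs \<in> rel A R \<longleftrightarrow> map f xs \<in> rel B R"
  using assms unfolding embedding_def by (auto simp: in_lists_conv_set subset_iff)

lemma embedding_restr: "embedding \<Sigma> f A B \<Longrightarrow> embedding \<Sigma> f (restr A X) B"
  unfolding embedding_def by (auto intro: inj_on_subset)

lemma embedding_into_restr:
  "embedding \<Sigma> f A (restr B X) \<Longrightarrow> embedding \<Sigma> f A B"
proof -
  assume e: "embedding \<Sigma> f A (restr B X)"
  note f = embeddingD[OF e]
  have "map f xs \<in> lists X" if "xs \<in> lists (universe A)" for xs
    using that f(1) by (auto simp: image_subset_iff)
  with e show ?thesis unfolding embedding_def by auto
qed

lemma isomorphic_sym:
  assumes "isomorphic \<Sigma> A B"
  shows "isomorphic \<Sigma> B A"
proof -
  obtain f where f: "embedding \<Sigma> f A B" "f ` universe A = universe B"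
    using assms by (auto simp: isomorphic_def)
  define g where "g = inv_into (universe A) f"
  have inj: "inj_on f (universe A)" using embeddingD(2)[OF f(1)] .
  have fg: "f (g y) = y" "g y \<in> universe A" if "y \<in> universe B" for y
    using that f(2) by (auto simp: g_def f_inv_into_f inv_into_into)
  have gf: "g ` universe B = universe A"
    using inv_into_image_cancel[OF inj subset_refl] f(2) by (simp add: g_def)
  have "embedding \<Sigma> g B A"
    unfolding embedding_def
  proof (intro conjI ballI impI)
    show "g ` universe B \<subseteq> universe A" using gf by simp
    show "inj_on g (universe B)" by (metis fg(1) inj_onI)
    fix R xs assume xs: "R \<in> syms \<Sigma>" "xs \<in> lists (universe B)" "length xs = arity \<Sigma> R"
    have "map f (map g xs) = xs" using xs fg by (auto intro!: map_idI)
    then show "xs \<in> rel B R \<longleftrightarrow> map g xs \<in> rel A R"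
      using embeddingD(3)[OF f(1), of R "map g xs"] xs fg by auto
  qed
  then show ?thesis using gf by (auto simp: isomorphic_def)
qed

lemma sat_qf_embedding:
  assumes "embedding \<Sigma> f A B" "wf_qf \<Sigma> m \<psi>" "\<And>i. i < m \<Longrightarrow> v i \<in> universe A"
  shows "sat_qf A v \<psi> \<longleftrightarrow> sat_qf B (\<lambda>i. f (v i)) \<psi>"
  using assms(2)
proof (induction \<psi>)
  case (Eq i j)
  then show ?case using embeddingD(2)[OF assms(1)] assms(3) by (auto dest: inj_onD)
next
  case (Atom R ns)
  then show ?case
    using embeddingD(3)[OF assms(1), of R "map v ns"] assms(3) by (auto simp: o_def)
qed auto

lemma sat_qf_cong:
  assumes "wf_qf \<Sigma> m \<psi>" "\<And>i. i < m \<Longrightarrow> v i = w i"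
  shows "sat_qf A v \<psi> \<longleftrightarrow> sat_qf A w \<psi>"
  using assms(1)
proof (induction \<psi>)
  case (Atom R ns)
  then have "map v ns = map w ns" using assms(2) by auto
  then show ?case by (simp only: sat_qf.simps)
qed (auto simp: assms(2))

text \<open>One notion for members of \<open>K\<close>, members of \<open>K_inf\<close> and the
  limit F, whose universe may lie in another type.\<close>

definition model :: "'r signature \<Rightarrow> 'r local_sentence set \<Rightarrow> ('a, 'r) struct \<Rightarrow> bool" where
  "model \<Sigma> \<Phi> A \<longleftrightarrow> is_structure \<Sigma> A \<and> (\<forall>\<phi> \<in> \<Phi>. sat_local \<Sigma> A \<phi>)"

lemma model_structure: "model \<Sigma> \<Phi> A \<Longrightarrow> is_structure \<Sigma> A"
  by (simp add: model_def)

lemma local_class_iff: "A \<in> local_class \<Sigma> \<Phi> \<longleftrightarrow> model \<Sigma> \<Phi> A \<and> finite (universe A)"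
  and local_class_inf_iff: "S \<in> local_class_inf \<Sigma> \<Phi> \<longleftrightarrow> model \<Sigma> \<Phi> S \<and> universe S = UNIV"
  by (auto simp: local_class_def local_class_inf_def model_def)

definition rename :: "('a \<Rightarrow> 'b) \<Rightarrow> ('a, 'r) struct \<Rightarrow> ('b, 'r) struct" where
  "rename f A = Struct (f ` universe A) (\<lambda>R. map f ` rel A R)"

lemma universe_rename [simp]: "universe (rename f A) = f ` universe A"
  and rel_rename [simp]: "rel (rename f A) R = map f ` rel A R"
  by (simp_all add: rename_def)

lemma is_structure_rename: "is_structure \<Sigma> A \<Longrightarrow> is_structure \<Sigma> (rename f A)"
  by (rule is_structureI) (use is_structureD[of \<Sigma> A] in fastforce)

lemma embedding_rename:
  assumes A: "is_structure \<Sigma> A" and inj: "inj_on f (universe A)"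
  shows "embedding \<Sigma> f A (rename f A)"
  unfolding embedding_def
proof (intro conjI ballI impI)
  fix R xs assume xs: "R \<in> syms \<Sigma>" "xs \<in> lists (universe A)" "length xs = arity \<Sigma> R"
  have "xs = ys" if "map f xs = map f ys" "ys \<in> rel A R" for ys
    using that xs is_structureD(3)[OF A that(2)] inj_onD[OF inj]
    by (intro map_inj_on[OF that(1)] inj_on_subset[OF inj]) auto
  then show "xs \<in> rel A R \<longleftrightarrow> map f xs \<in> rel (rename f A) R" by auto
qed (use inj in auto)

lemma isomorphic_rename:
  "is_structure \<Sigma> A \<Longrightarrow> inj_on f (universe A) \<Longrightarrow> isomorphic \<Sigma> A (rename f A)"
  using embedding_rename by (auto simp: isomorphic_def)

lemma rename_eqI:
  assumes "is_structure \<Sigma> A" "is_structure \<Sigma> B" "embedding \<Sigma> f A B" "f ` universe A = universe B"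
  shows "rename f A = B"
proof (rule struct_eqI)
  fix R
  show "rel (rename f A) R = rel B R"
  proof
    show "rel (rename f A) R \<subseteq> rel B R"
      using embeddingD(3)[OF assms(3)] by (auto dest: is_structureD[OF assms(1)])
    show "rel B R \<subseteq> rel (rename f A) R"
    proof
      fix ys assume ys: "ys \<in> rel B R"
      note s = is_structureD[OF assms(2) ys]
      then have "ys \<in> lists (f ` universe A)" using assms(4) by auto
      then obtain xs where xs: "xs \<in> lists (universe A)" "ys = map f xs"
        unfolding lists_image by auto
      then have "xs \<in> rel A R" using embeddingD(3)[OF assms(3), of R xs] s ys by auto
      then show "ys \<in> rel (rename f A) R" using xs by auto
    qed
  qed
qed (use assms in auto)

text \<open>\<open>arity_pos\<close> will be derived from the existence of a Fraisse limit. It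
  leaves only one model on the empty set, so that choices begin with singletons.\<close>

locale local_theory =
  fixes \<Sigma> :: "'r signature" and \<Phi> :: "'r local_sentence set"
  assumes loc_fin: "locally_finite \<Sigma>"
    and axioms: "local_axioms \<Sigma> \<Phi>"
    and arity_pos: "R \<in> syms \<Sigma> \<Longrightarrow> arity \<Sigma> R > 0"
begin

abbreviation "K \<equiv> local_class \<Sigma> \<Phi>"
abbreviation "K_inf \<equiv> local_class_inf \<Sigma> \<Phi>"

text \<open>A local sentence is guarded by an atom containing all its variables, and its conclusion
  is quantifier-free, so it can be checked tuple by tuple on the substructure of the entries. The
  witnessing model may change with the tuple.\<close>

lemma modelI_tuples:
  fixes A :: "('a, 'r) struct"
  assumes A: "is_structure \<Sigma> A"
    and B: "\<And>R xs. xs \<in> rel A R \<Longrightarrow>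
      \<exists>(B :: ('b, 'r) struct) f. model \<Sigma> \<Phi> B \<and> embedding \<Sigma> f (restr A (set xs)) B"
  shows "model \<Sigma> \<Phi> A"
  unfolding model_def
proof (intro conjI ballI A)
  fix \<phi> assume \<phi>: "\<phi> \<in> \<Phi>"
  obtain R \<psi> where R: "\<phi> = Local R \<psi>" by (cases \<phi>)
  have wf: "R \<in> syms \<Sigma>" "wf_qf \<Sigma> (arity \<Sigma> R) \<psi>"
    using axioms \<phi> by (auto simp: local_axioms_def R)
  have "sat_qf A (\<lambda>i. xs ! i) \<psi>"
    if "length xs = arity \<Sigma> R" "xs \<in> rel A R" for xs
  proof -
    obtain B :: "('b, 'r) struct" and f where B': "model \<Sigma> \<Phi> B"
      and f: "embedding \<Sigma> f (restr A (set xs)) B"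
      using B \<open>xs \<in> rel A R\<close> by blast
    have xs: "set xs \<subseteq> universe A" using is_structureD(3)[OF A that(2)] .
    have i: "embedding \<Sigma> id (restr A (set xs)) A"
      by (auto simp: embedding_def)
    have "map f xs \<in> rel B R"
      using embeddingD(3)[OF f, of R xs] wf that xs by auto
    moreover have "map f xs \<in> lists (universe B)"
      using embeddingD(1)[OF f] xs by (auto simp: image_subset_iff subset_iff)
    ultimately have "sat_qf B (\<lambda>i. map f xs ! i) \<psi>"
      using bspec[OF conjunct2[OF B'[unfolded model_def]] \<phi>] that by (simp add: R)
    then have "sat_qf B (\<lambda>i. f (xs ! i)) \<psi>"
      using sat_qf_cong[OF wf(2), of "\<lambda>i. map f xs ! i" "\<lambda>i. f (xs ! i)" B] that by simp
    then have "sat_qf (restr A (set xs)) (\<lambda>i. xs ! i) \<psi>"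
      using sat_qf_embedding[OF f wf(2), of "\<lambda>i. xs ! i"] that nth_mem xs by fastforce
    then show ?thesis
      using sat_qf_embedding[OF i wf(2), of "\<lambda>i. xs ! i"] that nth_mem xs by fastforce
  qed
  then show "sat_local \<Sigma> A \<phi>" by (auto simp: R)
qed

lemma model_embedding:
  assumes "model \<Sigma> \<Phi> B" "embedding \<Sigma> f A B" "is_structure \<Sigma> A"
  shows "model \<Sigma> \<Phi> A"
  using assms by (intro modelI_tuples) (auto intro: embedding_restr)

lemma model_restr: "model \<Sigma> \<Phi> A \<Longrightarrow> model \<Sigma> \<Phi> (restr A X)"
  by (rule model_embedding[where f = id])
     (auto intro: is_structure_restr dest: model_structure simp: embedding_def)

lemma model_rename: "model \<Sigma> \<Phi> A \<Longrightarrow> inj_on f (universe A) \<Longrightarrow> model \<Sigma> \<Phi> (rename f A)"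
  using isomorphic_sym[OF isomorphic_rename[of \<Sigma> A f]] model_structure[of \<Sigma> \<Phi> A]
    is_structure_rename[of \<Sigma> A f] model_embedding
  unfolding isomorphic_def by blast

lemma model_distinct:
  assumes "model \<Sigma> \<Phi> A" "xs \<in> rel A R"
  shows "distinct xs"
  unfolding distinct_conv_nth
proof (intro allI impI)
  fix i j assume ij: "i < length xs" "j < length xs" "i \<noteq> j"
  note s = is_structureD[OF model_structure[OF assms(1)] assms(2)]
  have "Local R (Neg (Eq i j)) \<in> \<Phi>"
    using axioms ij s by (auto simp: local_axioms_def general_irreflexivity_def)
  then have "sat_local \<Sigma> A (Local R (Neg (Eq i j)))"
    using assms(1) unfolding model_def by blast
  then show "xs ! i \<noteq> xs ! j" using s assms(2) by (auto simp: in_lists_conv_set)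
qed

lemma model_card:
  assumes "model \<Sigma> \<Phi> A" "xs \<in> rel A R"
  shows "card (set xs) = arity \<Sigma> R"
  using model_distinct[OF assms] is_structureD(2)[OF model_structure[OF assms(1)] assms(2)]
  by (simp add: distinct_card)

lemma model_card_le:
  assumes "model \<Sigma> \<Phi> A" "xs \<in> rel A R" "set xs \<subseteq> X" "finite X"
  shows "arity \<Sigma> R \<le> card X"
  using model_card[OF assms(1,2)] card_mono[OF assms(4,3)] by simp

text \<open>Dropping relations could falsify a conclusion. But below a surviving tuple nothing is
  dropped: by irreflexivity, relations among at most k points have arity at most k.\<close>

lemma model_frame:
  fixes A :: "('b, 'r) struct"
  assumes "model \<Sigma> \<Phi> A"
  shows "model \<Sigma> \<Phi> (frame \<Sigma> k A)"
proof (rule modelI_tuples[where 'b = 'b])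
  show "is_structure \<Sigma> (frame \<Sigma> k A)" using assms by (simp add: is_structure_frame model_def)
  fix R and xs :: "'b list" assume xs: "xs \<in> rel (frame \<Sigma> k A) R"
  then have *: "arity \<Sigma> R \<le> k" "card (set xs) = arity \<Sigma> R"
    using model_card[OF assms] by (auto split: if_splits)
  have "arity \<Sigma> Q \<le> k" if "ys \<in> rel A Q" "set ys \<subseteq> set xs" for Q ys
    using model_card_le[OF assms that] * by auto
  then have "embedding \<Sigma> id (restr (frame \<Sigma> k A) (set xs)) A"
    by (auto simp: embedding_def in_lists_conv_set subset_iff)
  then show "\<exists>(B :: ('b, 'r) struct) f. model \<Sigma> \<Phi> B \<and> embedding \<Sigma> f (restr (frame \<Sigma> k A) (set xs)) B"
    using assms by (intro exI[of _ A] exI[of _ id]) simp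
qed

lemma frame_card_eq:
  assumes "model \<Sigma> \<Phi> A" "finite (universe A)" "card (universe A) \<le> k"
  shows "frame \<Sigma> k A = A"
proof (rule struct_eqI)
  fix R
  show "rel (frame \<Sigma> k A) R = rel A R"
    using assms model_card_le[OF assms(1) _ is_structureD(3)[OF model_structure[OF assms(1)]] assms(2)]
    by (fastforce split: if_splits)
qed auto

text \<open>A tuple of arity at most k lies on a set of at most k points, where taking the k-frame
  changes nothing. This turns the condition defining \<open>O_inf\<close> into one condition per
  small set.\<close>

lemma frame_restr_eq_iff:
  assumes A: "model \<Sigma> \<Phi> A" and B: "model \<Sigma> \<Phi> B"
    and X: "X \<subseteq> universe A" "X \<subseteq> universe B"
  shows "frame \<Sigma> k (restr A X) = frame \<Sigma> k (restr B X) \<longleftrightarrow>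
    (\<forall>Y \<subseteq> X. finite Y \<longrightarrow> card Y \<le> k \<longrightarrow> restr A Y = restr B Y)"
proof (intro iffI allI impI)
  fix Y assume eq: "frame \<Sigma> k (restr A X) = frame \<Sigma> k (restr B X)"
    and Y: "Y \<subseteq> X" "finite Y" "card Y \<le> k"
  have "restr A Y = frame \<Sigma> k (restr A Y)"
    using Y X by (intro frame_card_eq[symmetric] model_restr A) (auto simp: Int_absorb1)
  also have "\<dots> = restr (frame \<Sigma> k (restr A X)) Y"
    using Y by (intro struct_eqI) auto
  also have "\<dots> = restr (frame \<Sigma> k (restr B X)) Y" by (simp add: eq)
  also have "\<dots> = frame \<Sigma> k (restr B Y)"
    using Y by (intro struct_eqI) auto
  also have "\<dots> = restr B Y"
    using Y X by (intro frame_card_eq model_restr B) (auto simp: Int_absorb1)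
  finally show "restr A Y = restr B Y" .
next
  assume eq: "\<forall>Y \<subseteq> X. finite Y \<longrightarrow> card Y \<le> k \<longrightarrow> restr A Y = restr B Y"
  have *: "xs \<in> rel D R" if C: "model \<Sigma> \<Phi> C" and xs: "xs \<in> rel C R" "set xs \<subseteq> X" "arity \<Sigma> R \<le> k"
    and eq: "\<forall>Y \<subseteq> X. finite Y \<longrightarrow> card Y \<le> k \<longrightarrow> restr C Y = restr D Y" for C D R xs
  proof -
    have "restr C (set xs) = restr D (set xs)" using eq xs model_card[OF C xs(1)] by auto
    then have "rel (restr C (set xs)) R = rel (restr D (set xs)) R" by simp
    then show ?thesis using xs by auto
  qed
  show "frame \<Sigma> k (restr A X) = frame \<Sigma> k (restr B X)"
  proof (rule struct_eqI)
    fix R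
    show "rel (frame \<Sigma> k (restr A X)) R = rel (frame \<Sigma> k (restr B X)) R"
      using *[OF A, of _ R B] *[OF B, of _ R A] eq by (auto simp: in_lists_conv_set subset_iff)
  qed (use X in auto)
qed

section \<open>Counting models on a finite set\<close>

text \<open>A crude bound: the factor for R counts all relations of its arity on n points. Only its
  dependence on n alone matters, since it must bound probabilities uniformly over all sets of the
  same size.\<close>

definition max_structs :: "nat \<Rightarrow> nat" where
  "max_structs n = (\<Prod>R \<in> {R \<in> syms \<Sigma>. arity \<Sigma> R \<le> n}. 2 ^ (n ^ arity \<Sigma> R))"

lemma finite_syms: "finite {R \<in> syms \<Sigma>. arity \<Sigma> R \<le> n}"
proof -
  have "{R \<in> syms \<Sigma>. arity \<Sigma> R \<le> n} = (\<Union>m\<in>{..n}. {R \<in> syms \<Sigma>. arity \<Sigma> R = m})" by auto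
  then show ?thesis using loc_fin by (simp add: locally_finite_def)
qed

lemma models_on_finite:
  assumes X: "finite X"
  shows "finite {A. model \<Sigma> \<Phi> A \<and> universe A = X}" (is "finite ?M")
    and "card {A. model \<Sigma> \<Phi> A \<and> universe A = X} \<le> max_structs (card X)"
proof -
  let ?I = "{R \<in> syms \<Sigma>. arity \<Sigma> R \<le> card X}"
  let ?L = "\<lambda>R. {xs. set xs \<subseteq> X \<and> length xs = arity \<Sigma> R}"
  let ?P = "Pi\<^sub>E ?I (\<lambda>R. Pow (?L R))"
  have fin: "finite ?P"
    using X finite_syms by (intro finite_PiE) (auto simp: finite_lists_length_eq)
  have inj: "inj_on (\<lambda>A. restrict (rel A) ?I) ?M"
  proof (rule inj_onI, rule struct_eqI)
    fix A B R assume AB: "A \<in> ?M" "B \<in> ?M" "restrict (rel A) ?I = restrict (rel B) ?I"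
    \<comment> \<open>By irreflexivity, symbols of arity above \<open>card X\<close> are empty on X,
      so finitely many symbols determine the model.\<close>
    have "rel C R = {}" if "C \<in> ?M" "R \<notin> ?I" for C
      using that model_card_le[of C _ R X] is_structureD[of \<Sigma> C _ R] X
      by (force dest: model_structure)
    moreover have "rel A R = rel B R" if "R \<in> ?I"
      using fun_cong[OF AB(3), of R] that by (auto simp: restrict_def split: if_splits)
    ultimately show "rel A R = rel B R" using AB by blast
  qed auto
  have sub: "(\<lambda>A. restrict (rel A) ?I) ` ?M \<subseteq> ?P"
  proof (rule image_subsetI, intro PiE_I)
    fix A R assume "A \<in> ?M" "R \<in> ?I"
    then show "restrict (rel A) ?I R \<in> Pow (?L R)"
      using is_structureD(2,3)[OF model_structure, of \<Sigma> \<Phi> A _ R] by simp blast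
  qed (simp only: restrict_def if_False)
  show "finite ?M" using fin inj sub by (meson finite_imageD finite_subset)
  have "card ?M \<le> card ?P" by (rule card_inj_on_le[OF inj sub fin])
  also have "\<dots> = max_structs (card X)"
    using finite_syms X
    by (simp add: card_PiE max_structs_def card_Pow finite_lists_length_eq card_lists_length_eq)
  finally show "card ?M \<le> max_structs (card X)" .
qed

lemma countable_K: "countable K"
proof -
  have "K = (\<Union>X \<in> {X. finite X}. {A. model \<Sigma> \<Phi> A \<and> universe A = X})"
    by (rule set_eqI) (simp add: local_class_iff)
  moreover have "countable \<dots>"
    by (rule countable_UN) (use countable_Collect_finite models_on_finite(1) in \<open>auto intro: countable_finite\<close>)
  ultimately show ?thesis by simp
qed

end

section \<open>Back and forth\<close>

text \<open>Partial isomorphisms are sets of pairs, so that unions of chains need no gluing.\<close>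

definition partial_iso ::
  "'r signature \<Rightarrow> ('a, 'r) struct \<Rightarrow> ('b, 'r) struct \<Rightarrow> ('a \<times> 'b) set \<Rightarrow> bool" where
  "partial_iso \<Sigma> A B r \<longleftrightarrow> r \<subseteq> universe A \<times> universe B \<and>
     (\<forall>p \<in> r. \<forall>q \<in> r. fst p = fst q \<longleftrightarrow> snd p = snd q) \<and>
     (\<forall>R \<in> syms \<Sigma>. \<forall>ps \<in> lists r. length ps = arity \<Sigma> R \<longrightarrow>
        (map fst ps \<in> rel A R \<longleftrightarrow> map snd ps \<in> rel B R))"

lemma partial_iso_graph_iff:
  assumes "X \<subseteq> universe A"
  shows "partial_iso \<Sigma> A B ((\<lambda>x. (x, f x)) ` X) \<longleftrightarrow> embedding \<Sigma> f (restr A X) B"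
proof -
  have "(\<forall>ps \<in> lists ((\<lambda>x. (x, f x)) ` X). length ps = n \<longrightarrow>
          (map fst ps \<in> rel A R \<longleftrightarrow> map snd ps \<in> rel B R)) \<longleftrightarrow>
        (\<forall>xs \<in> lists X. length xs = n \<longrightarrow> (xs \<in> rel A R \<longleftrightarrow> map f xs \<in> rel B R))" for n R
    unfolding lists_image ball_simps by (simp add: o_def)
  moreover have "universe A \<inter> X = X" using assms by auto
  ultimately show ?thesis
    using assms by (auto simp: partial_iso_def embedding_def inj_on_def)
qed

lemma partial_iso_graphE:
  assumes "partial_iso \<Sigma> A B r"
  obtains f where "r = (\<lambda>x. (x, f x)) ` fst ` r" "embedding \<Sigma> f (restr A (fst ` r)) B"
    "fst ` r \<subseteq> universe A"
proof -
  define f where "f x = (SOME y. (x, y) \<in> r)" for x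
  have "f x = y" if "(x, y) \<in> r" for x y
    unfolding f_def using assms that someI[of "\<lambda>y. (x, y) \<in> r" y]
    by (fastforce simp: partial_iso_def)
  then have r: "r = (\<lambda>x. (x, f x)) ` fst ` r" by force
  moreover have sub: "fst ` r \<subseteq> universe A" using assms by (auto simp: partial_iso_def)
  ultimately show thesis using that assms partial_iso_graph_iff[OF sub, of \<Sigma> B f] by metis
qed

text \<open>Each condition concerns finitely many pairs, which already lie in one member of the
  chain.\<close>

lemma partial_iso_Union_chain:
  fixes r :: "nat \<Rightarrow> ('a \<times> 'b) set"
  assumes "\<And>n. partial_iso \<Sigma> A B (r n)" "\<And>n. r n \<subseteq> r (Suc n)"
  shows "partial_iso \<Sigma> A B (\<Union>n. r n)"
proof -
  have mono: "r m \<subseteq> r n" if "m \<le> n" for m n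
    using lift_Suc_mono_le[of r, OF assms(2) that] .
  have fin: "\<exists>n. set ps \<subseteq> r n" if "set ps \<subseteq> (\<Union>n. r n)" for ps
    using that
  proof (induction ps)
    case (Cons p ps)
    then obtain m n where "p \<in> r m" "set ps \<subseteq> r n" by auto
    then have "set (p # ps) \<subseteq> r (max m n)" using mono[of m "max m n"] mono[of n "max m n"] by auto
    then show ?case by blast
  qed auto
  show ?thesis
    unfolding partial_iso_def
  proof (intro conjI ballI impI)
    show "(\<Union>n. r n) \<subseteq> universe A \<times> universe B"
      using assms(1) unfolding partial_iso_def by blast
  next
    fix p q assume "p \<in> (\<Union>n. r n)" "q \<in> (\<Union>n. r n)"
    then obtain n where "p \<in> r n" "q \<in> r n" using fin[of "[p, q]"] by auto
    then show "fst p = fst q \<longleftrightarrow> snd p = snd q"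
      using assms(1)[of n] unfolding partial_iso_def by blast
  next
    fix R ps assume ps: "R \<in> syms \<Sigma>" "ps \<in> lists (\<Union>n. r n)" "length ps = arity \<Sigma> R"
    then obtain n where "set ps \<subseteq> r n" using fin[of ps] by auto
    then show "map fst ps \<in> rel A R \<longleftrightarrow> map snd ps \<in> rel B R"
      using assms(1)[of n] ps unfolding partial_iso_def by (auto simp: lists_eq_set)
  qed
qed

lemma back_and_forth:
  assumes count: "countable (universe A)" "countable (universe B)"
    and empty: "partial_iso \<Sigma> A B {}"
    and fwd: "\<And>r a. partial_iso \<Sigma> A B r \<Longrightarrow> finite r \<Longrightarrow> a \<in> universe A \<Longrightarrow>
      \<exists>b. partial_iso \<Sigma> A B (insert (a, b) r)"
    and bwd: "\<And>r b. partial_iso \<Sigma> A B r \<Longrightarrow> finite r \<Longrightarrow> b \<in> universe B \<Longrightarrow>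
      \<exists>a. partial_iso \<Sigma> A B (insert (a, b) r)"
  shows "isomorphic \<Sigma> A B"
proof -
  let ?P = "\<lambda>r. partial_iso \<Sigma> A B r \<and> finite r"
  \<comment> \<open>Stage n puts the element coded n by \<open>to_nat_on\<close>, if there is one,
    into the domain and likewise into the range.\<close>
  let ?Q = "\<lambda>n r r'. r \<subseteq> r' \<and> (\<forall>a \<in> universe A. to_nat_on (universe A) a = n \<longrightarrow> a \<in> fst ` r') \<and>
    (\<forall>b \<in> universe B. to_nat_on (universe B) b = n \<longrightarrow> b \<in> snd ` r')"
  have step: "\<exists>r'. ?P r' \<and> ?Q n r r'" if r: "?P r" for n r
  proof -
    obtain r1 where r1: "?P r1" "r \<subseteq> r1"
      "\<forall>a \<in> universe A. to_nat_on (universe A) a = n \<longrightarrow> a \<in> fst ` r1"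
    proof (cases "\<exists>a \<in> universe A. to_nat_on (universe A) a = n")
      case True
      then obtain a where a: "a \<in> universe A" "to_nat_on (universe A) a = n" by blast
      obtain b where "partial_iso \<Sigma> A B (insert (a, b) r)" using fwd r a by blast
      moreover have "a' = a" if "a' \<in> universe A" "to_nat_on (universe A) a' = n" for a'
        using that a count(1) by (metis to_nat_on_inj)
      ultimately show ?thesis using that[of "insert (a, b) r"] r by auto
    qed (use r that in blast)
    obtain r2 where r2: "?P r2" "r1 \<subseteq> r2"
      "\<forall>b \<in> universe B. to_nat_on (universe B) b = n \<longrightarrow> b \<in> snd ` r2"
    proof (cases "\<exists>b \<in> universe B. to_nat_on (universe B) b = n")
      case True
      then obtain b where b: "b \<in> universe B" "to_nat_on (universe B) b = n" by blast
      obtain a where "partial_iso \<Sigma> A B (insert (a, b) r1)" using bwd r1 b by blast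
      moreover have "b' = b" if "b' \<in> universe B" "to_nat_on (universe B) b' = n" for b'
        using that b count(2) by (metis to_nat_on_inj)
      ultimately show ?thesis using that[of "insert (a, b) r1"] r1 by auto
    qed (use r1 that in blast)
    show ?thesis
      using r1(2,3) r2 by (intro exI[of _ r2]) blast
  qed
  have "\<exists>r. ?P r" using empty by blast
  from dependent_nat_choice[of "\<lambda>_. ?P" ?Q, OF this step]
  obtain r where r: "\<And>n. ?P (r n)" "\<And>n. ?Q n (r n) (r (Suc n))" by blast
  let ?r = "\<Union>n. r n"
  have iso: "partial_iso \<Sigma> A B ?r" using r by (intro partial_iso_Union_chain) auto
  then obtain f where f: "?r = (\<lambda>x. (x, f x)) ` fst ` ?r"
    "embedding \<Sigma> f (restr A (fst ` ?r)) B" "fst ` ?r \<subseteq> universe A"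
    by (rule partial_iso_graphE)
  have "universe A \<subseteq> fst ` ?r" using r(2) by fastforce
  with f(3) have dom: "fst ` ?r = universe A" by (rule subset_antisym)
  have "universe B \<subseteq> snd ` ?r" using r(2) by fastforce
  moreover have "snd ` ?r \<subseteq> universe B" using iso unfolding partial_iso_def by auto
  moreover have "snd ` ?r = f ` fst ` ?r" by (subst f(1)) (auto simp: image_image)
  ultimately have "f ` universe A = universe B" unfolding dom by auto
  with dom show ?thesis
    using f(2) unfolding isomorphic_def embedding_def by (intro exI[of _ f]) (auto simp: lists_eq_set)
qed

text \<open>Copies part of a structure of arbitrary type, such as F, onto natural numbers, where
  members of \<open>K\<close> live.\<close>

definition pullback :: "'r signature \<Rightarrow> ('a \<Rightarrow> 'b) \<Rightarrow> 'a set \<Rightarrow> ('b, 'r) struct \<Rightarrow> ('a, 'r) struct" where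
  "pullback \<Sigma> f X B =
     Struct X (\<lambda>R. {xs \<in> lists X. R \<in> syms \<Sigma> \<and> length xs = arity \<Sigma> R \<and> map f xs \<in> rel B R})"

lemma universe_pullback [simp]: "universe (pullback \<Sigma> f X B) = X"
  and rel_pullback [simp]: "rel (pullback \<Sigma> f X B) R =
    {xs \<in> lists X. R \<in> syms \<Sigma> \<and> length xs = arity \<Sigma> R \<and> map f xs \<in> rel B R}"
  by (simp_all add: pullback_def)

lemma is_structure_pullback: "is_structure \<Sigma> (pullback \<Sigma> f X B)"
  by (rule is_structureI) auto

lemma embedding_pullback:
  "inj_on f X \<Longrightarrow> f ` X \<subseteq> universe B \<Longrightarrow> embedding \<Sigma> f (pullback \<Sigma> f X B) B"
  by (auto simp: embedding_def)

section \<open>The extension property characterises the Fraisse limit\<close>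

context local_theory
begin

text \<open>Stated by equality of substructures instead of embeddings: each instance then combines
  conditions \<open>restr S X = A\<close>, which are basic sets, and there are only countably many
  B, z and w. F does not occur, and w may equal z.\<close>

definition extension_property :: "(nat, 'r) struct \<Rightarrow> bool" where
  "extension_property S \<longleftrightarrow> (\<forall>B \<in> K. \<forall>z \<in> universe B.
     restr S (universe B - {z}) = restr B (universe B - {z}) \<longrightarrow>
     (\<exists>w. w \<notin> universe B - {z} \<and>
        restr S (insert w (universe B - {z})) = rename (id(z := w)) B))"

context
  fixes F :: "('a, 'r) struct"
  assumes F: "fraisse_limit \<Sigma> K F"
begin

lemma limit_structure: "is_structure \<Sigma> F"
  and limit_countable: "countable (universe F)"
  using F by (auto simp: fraisse_limit_def)

lemma limit_model: "model \<Sigma> \<Phi> F"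
proof (rule modelI_tuples[OF limit_structure])
  fix R xs assume xs: "xs \<in> rel F R"
  then have "set xs \<subseteq> universe F" using is_structureD(3)[OF limit_structure] by blast
  then obtain A where A: "A \<in> K" "isomorphic \<Sigma> A (restr F (set xs))"
    using F unfolding fraisse_limit_def by blast
  obtain f where "embedding \<Sigma> f (restr F (set xs)) A"
    using isomorphic_sym[OF A(2)] by (auto simp: isomorphic_def)
  then show "\<exists>(B :: (nat, 'r) struct) f. model \<Sigma> \<Phi> B \<and> embedding \<Sigma> f (restr F (set xs)) B"
    using A(1) by (auto simp: local_class_iff)
qed

lemma limit_universal: "A \<in> K \<Longrightarrow> \<exists>h. embedding \<Sigma> h A F"
  using F embedding_into_restr unfolding fraisse_limit_def isomorphic_def by metis

lemma limit_extends:
  assumes "B \<in> K" "X \<subseteq> universe B" "embedding \<Sigma> f (restr B X) F"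
  obtains g where "embedding \<Sigma> g B F" "\<And>x. x \<in> X \<Longrightarrow> g x = f x"
proof -
  have "weakly_homogeneous \<Sigma> F" using F by (simp add: fraisse_limit_def)
  then show thesis
    using assms that limit_universal[OF assms(1)] model_structure
    unfolding weakly_homogeneous_def local_class_iff by metis
qed

text \<open>Weak homogeneity extends the isomorphism, restricted to the base, to an embedding of B
  into F; the preimage of the image of z is the required w.\<close>

lemma isomorphic_limitD:
  assumes S: "S \<in> K_inf" and iso: "isomorphic \<Sigma> S F"
  shows "extension_property S"
  unfolding extension_property_def
proof (intro ballI impI)
  fix B z assume B: "B \<in> K" and z: "z \<in> universe B"
    and eq: "restr S (universe B - {z}) = restr B (universe B - {z})"
  let ?Y = "universe B - {z}"
  have US: "universe S = UNIV" and mS: "model \<Sigma> \<Phi> S" using S by (auto simp: local_class_inf_iff)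
  have mB: "model \<Sigma> \<Phi> B" using B by (auto simp: local_class_iff)
  obtain f where f: "embedding \<Sigma> f S F" "f ` UNIV = universe F"
    using iso US by (auto simp: isomorphic_def)
  have "embedding \<Sigma> f (restr B ?Y) F" using embedding_restr[OF f(1), of ?Y] by (simp add: eq)
  then obtain g where g: "embedding \<Sigma> g B F" "\<And>x. x \<in> ?Y \<Longrightarrow> g x = f x"
    using limit_extends[OF B, of ?Y f] by blast
  have "g z \<in> universe F" using embeddingD(1)[OF g(1)] z by auto
  then obtain w where w: "g z = f w" using f(2) by auto
  have wY: "w \<notin> ?Y"
    using embeddingD(2)[OF g(1)] g(2) w z by (metis DiffE inj_onD singletonI)
  let ?h = "id(z := w)"
  have gh: "g x = f (?h x)" if "x \<in> universe B" for x using that g(2) w by auto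
  have im: "?h ` universe B = insert w ?Y" using z by auto
  have "embedding \<Sigma> ?h B (restr S (insert w ?Y))"
    unfolding embedding_def
  proof (intro conjI ballI impI)
    show "?h ` universe B \<subseteq> universe (restr S (insert w ?Y))" using im US by auto
    show "inj_on ?h (universe B)" using wY by (auto simp: inj_on_def)
    fix R xs assume xs: "R \<in> syms \<Sigma>" "xs \<in> lists (universe B)" "length xs = arity \<Sigma> R"
    have "xs \<in> rel B R \<longleftrightarrow> map g xs \<in> rel F R" using embeddingD(3)[OF g(1)] xs by auto
    also have "map g xs = map f (map ?h xs)" using xs gh by auto
    also have "\<dots> \<in> rel F R \<longleftrightarrow> map ?h xs \<in> rel S R"
      using embeddingD(3)[OF f(1), of R "map ?h xs"] xs US by auto
    also have "\<dots> \<longleftrightarrow> map ?h xs \<in> rel (restr S (insert w ?Y)) R"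
      using xs im by (auto simp: image_subset_iff)
    finally show "xs \<in> rel B R \<longleftrightarrow> map ?h xs \<in> rel (restr S (insert w ?Y)) R" .
  qed
  then have "rename ?h B = restr S (insert w ?Y)"
    using im US model_structure[OF mB] is_structure_restr[OF model_structure[OF mS]]
    by (intro rename_eqI[of \<Sigma>]) auto
  then show "\<exists>w. w \<notin> ?Y \<and> restr S (insert w ?Y) = rename (id(z := w)) B"
    using wY by (intro exI[of _ w]) auto
qed

text \<open>Forth is weak homogeneity of F; back is the extension property of S.\<close>

lemma extension_property_isomorphic:
  assumes S: "S \<in> K_inf" and ext: "extension_property S"
  shows "isomorphic \<Sigma> S F"
proof (rule back_and_forth)
  have US: "universe S = UNIV" and mS: "model \<Sigma> \<Phi> S" using S by (auto simp: local_class_inf_iff)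
  show "countable (universe S)" "countable (universe F)" using limit_countable by auto
  \<comment> \<open>Over the empty relation only the empty tuple is tested, hence only nullary
    symbols could fail.\<close>
  show "partial_iso \<Sigma> S F {}" using arity_pos by (fastforce simp: partial_iso_def)
  fix r assume r: "partial_iso \<Sigma> S F r" and fin: "finite r"
  define Y where "Y = fst ` r"
  obtain p where p: "r = (\<lambda>x. (x, p x)) ` Y" "embedding \<Sigma> p (restr S Y) F" "Y \<subseteq> universe S"
    by (rule partial_iso_graphE[OF r, folded Y_def])
  have finY: "finite Y" using fin by (simp add: Y_def)
  {
    fix a
    let ?B = "restr S (insert a Y)"
    have "?B \<in> K" using finY US mS by (auto simp: local_class_iff intro: model_restr)
    moreover have "restr ?B Y = restr S Y" by (rule restr_restr) auto
    ultimately obtain g where g: "embedding \<Sigma> g ?B F" "\<And>x. x \<in> Y \<Longrightarrow> g x = p x"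
      using limit_extends[of ?B Y p] p(2) US by auto
    have "insert (a, g a) r = (\<lambda>x. (x, g x)) ` insert a Y" using p(1) g(2) by auto
    then show "\<exists>b. partial_iso \<Sigma> S F (insert (a, b) r)"
      using g(1) US partial_iso_graph_iff[of "insert a Y" S \<Sigma> F g] by (metis top_greatest)
  }
  fix b assume b: "b \<in> universe F"
  show "\<exists>a. partial_iso \<Sigma> S F (insert (a, b) r)"
  proof (cases "b \<in> snd ` r")
    case True
    then obtain a where "(a, b) \<in> r" by auto
    then show ?thesis using r by (metis insert_absorb)
  next
    case False
    then have bY: "b \<notin> p ` Y" using p(1) by (force simp: image_image)
    \<comment> \<open>z is a provisional name for b among the naturals, making the one-point
      extension a member of \<open>K\<close>. The extension property then replaces z by an actual
      witness w in S.\<close>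
    obtain z where z: "z \<notin> Y" using finY ex_new_if_finite infinite_UNIV_nat by blast
    let ?X = "insert z Y" and ?g = "p(z := b)"
    note pe = embeddingD[OF p(2)]
    have injp: "inj_on p Y" and pY: "p ` Y \<subseteq> universe F" using pe(1,2) US by auto
    have gY: "?g ` Y = p ` Y" using z by (auto simp: image_def)
    have injg: "inj_on ?g ?X" using injp bY z by (auto simp: inj_on_def)
    let ?B = "pullback \<Sigma> ?g ?X F"
    have e: "embedding \<Sigma> ?g ?B F"
      using injg pY b gY by (intro embedding_pullback) auto
    then have mB: "model \<Sigma> \<Phi> ?B" using model_embedding[OF limit_model _ is_structure_pullback] by blast
    then have B: "?B \<in> K" using finY by (simp add: local_class_iff)
    have X: "universe ?B - {z} = Y" using z by auto
    have "restr S Y = restr ?B Y"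
    proof (rule struct_eqI)
      fix R
      have "xs \<in> rel S R \<longleftrightarrow> xs \<in> rel ?B R" if "xs \<in> lists Y" for xs
      proof -
        have eq: "map ?g xs = map p xs" using that z by auto
        have "R \<in> syms \<Sigma> \<Longrightarrow> length xs = arity \<Sigma> R \<Longrightarrow> xs \<in> rel S R \<longleftrightarrow> map p xs \<in> rel F R"
          using pe(3)[of R xs] that US by auto
        then show ?thesis
          unfolding rel_pullback mem_Collect_eq eq
          using that is_structureD(1,2)[OF model_structure[OF mS], of xs R] by auto
      qed
      then show "rel (restr S Y) R = rel (restr ?B Y) R" unfolding rel_restr by blast
    qed (use US in auto)
    then obtain w where w: "w \<notin> Y" "restr S (insert w Y) = rename (id(z := w)) ?B"
      using ext B X unfolding extension_property_def by (metis insertI1 universe_pullback)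
    let ?h = "id(z := w)" and ?q = "p(w := b)"
    have qh: "?q (?h x) = ?g x" if "x \<in> ?X" for x using that w z by auto
    have im: "?h ` ?X = insert w Y" using z by auto
    have injh: "inj_on ?h (universe ?B)" using w z by (auto simp: inj_on_def)
    note eh = embedding_rename[OF is_structure_pullback injh]
    have "embedding \<Sigma> ?q (restr S (insert w Y)) F"
      unfolding embedding_def
    proof (intro conjI ballI impI)
      have "?q ` Y = p ` Y" using w by (auto simp: image_def)
      then show "?q ` universe (restr S (insert w Y)) \<subseteq> universe F" using pY b US by auto
      show "inj_on ?q (universe (restr S (insert w Y)))" using injp bY w US by (auto simp: inj_on_def)
      fix R ys assume ys: "R \<in> syms \<Sigma>" "ys \<in> lists (universe (restr S (insert w Y)))" "length ys = arity \<Sigma> R"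
      then have "ys \<in> lists (?h ` ?X)" using im US by auto
      then obtain xs where xs: "xs \<in> lists ?X" "ys = map ?h xs" unfolding lists_image by blast
      have "ys \<in> rel (restr S (insert w Y)) R \<longleftrightarrow> xs \<in> rel ?B R"
        unfolding w(2) xs(2) using embeddingD(3)[OF eh, of R xs] xs ys by auto
      also have "\<dots> \<longleftrightarrow> map ?g xs \<in> rel F R" using embeddingD(3)[OF e, of R xs] xs ys by auto
      also have "map ?g xs = map ?q ys"
        unfolding xs(2) map_map o_def by (rule map_cong[OF refl], rule qh[symmetric]) (use xs(1) in auto)
      finally show "ys \<in> rel (restr S (insert w Y)) R \<longleftrightarrow> map ?q ys \<in> rel F R" .
    qed
    moreover have "insert (w, b) r = (\<lambda>x. (x, ?q x)) ` insert w Y" using p(1) w(1) by auto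
    ultimately show ?thesis
      using US partial_iso_graph_iff[of "insert w Y" S \<Sigma> F ?q] by (metis top_greatest)
  qed
qed

end

end

section \<open>A random structure built from independent choices\<close>

context local_theory
begin

text \<open>The possible choices for the relations of top arity over a structure \<open>B\<close> without such
  relations. Inserting \<open>B\<close> only matters for junk arguments; it makes every set of choices nonempty.\<close>

definition exts :: "(nat, 'r) struct \<Rightarrow> (nat, 'r) struct set" where
  "exts B = insert B {C \<in> K. universe C = universe B \<and> frame \<Sigma> (card (universe B) - 1) C = B}"

text \<open>The name of the coordinate consulted at X: what is known there before the relations of
  arity \<open>card X\<close> are chosen. It keeps X as its universe, so distinct subsets of A
  consult distinct coordinates.\<close>

definition lower :: "(nat, 'r) struct \<Rightarrow> nat set \<Rightarrow> (nat, 'r) struct" where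
  "lower A X = frame \<Sigma> (card X - 1) (restr A X)"

lemma universe_lower [simp]: "universe (lower A X) = universe A \<inter> X"
  by (simp add: lower_def)

lemma exts_subset: "exts B \<subseteq> insert B {C. model \<Sigma> \<Phi> C \<and> universe C = universe B}"
  by (auto simp: exts_def local_class_iff)

lemma finite_exts: "finite (exts B)"
proof (cases "finite (universe B)")
  case True
  then show ?thesis
    using finite_subset[OF exts_subset] models_on_finite(1)[OF True] by (simp add: finite_insert)
next
  case False
  then have "C \<notin> K" if "universe C = universe B" for C using that by (simp add: local_class_iff)
  then have "exts B = {B}" unfolding exts_def by blast
  then show ?thesis by simp
qed

lemma card_exts_pos: "card (exts B) > 0"
  using finite_exts by (auto simp: card_gt_0_iff exts_def)

lemma card_exts_le:
  assumes "finite (universe B)"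
  shows "card (exts B) \<le> Suc (max_structs (card (universe B)))"
proof -
  have "card (exts B) \<le> card (insert B {C. model \<Sigma> \<Phi> C \<and> universe C = universe B})"
    using models_on_finite(1)[OF assms] exts_subset by (intro card_mono) auto
  also have "\<dots> \<le> Suc (card {C. model \<Sigma> \<Phi> C \<and> universe C = universe B})"
    by (rule card_insert_le_m1) auto
  finally show ?thesis using models_on_finite(2)[OF assms] by simp
qed

lemma restr_in_exts:
  assumes "model \<Sigma> \<Phi> A" "finite X" "X \<subseteq> universe A"
  shows "restr A X \<in> exts (lower A X)"
  using assms by (auto simp: exts_def lower_def local_class_iff Int_absorb1 intro: model_restr)

text \<open>The recursion is on arity because the coordinate for a set of \<open>Suc k\<close>
  points is named by what stage k has built on it. Only symbols of arity exactly
  \<open>Suc k\<close> are read off the choice.\<close>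

primrec stage :: "((nat, 'r) struct \<Rightarrow> (nat, 'r) struct) \<Rightarrow> nat \<Rightarrow> (nat, 'r) struct" where
  "stage \<omega> 0 = Struct UNIV (\<lambda>_. {})"
| "stage \<omega> (Suc k) = Struct UNIV (\<lambda>R. rel (stage \<omega> k) R \<union>
     {xs. R \<in> syms \<Sigma> \<and> arity \<Sigma> R = Suc k \<and> length xs = Suc k \<and> distinct xs \<and>
        xs \<in> rel (\<omega> (restr (stage \<omega> k) (set xs))) R})"

definition sample :: "((nat, 'r) struct \<Rightarrow> (nat, 'r) struct) \<Rightarrow> (nat, 'r) struct" where
  "sample \<omega> = Struct UNIV (\<lambda>R. rel (stage \<omega> (arity \<Sigma> R)) R)"

lemma universe_sample [simp]: "universe (sample \<omega>) = UNIV"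
  by (simp add: sample_def)

lemma stage_eq_frame: "stage \<omega> k = frame \<Sigma> k (sample \<omega>)"
proof -
  have *: "rel (stage \<omega> k) R = {}" if "k < arity \<Sigma> R" for k R
    using that by (induction k) auto
  have "rel (stage \<omega> k) R = rel (sample \<omega>) R" if "arity \<Sigma> R \<le> k" for R
    using that
  proof (induction k)
    case (Suc k)
    then show ?case by (cases "arity \<Sigma> R = Suc k") (auto simp: sample_def)
  qed (simp add: sample_def)
  moreover have "universe (stage \<omega> k) = UNIV" by (cases k) auto
  ultimately show ?thesis using * by (intro struct_eqI) (auto simp: not_le)
qed

text \<open>A fixed-point equation for the sample, which stands in for the recursion in all later
  arguments.\<close>

lemma rel_sample:
  "xs \<in> rel (sample \<omega>) R \<longleftrightarrow> R \<in> syms \<Sigma> \<and> length xs = arity \<Sigma> R \<and> distinct xs \<and>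
     xs \<in> rel (\<omega> (lower (sample \<omega>) (set xs))) R"
proof (cases "arity \<Sigma> R")
  case 0
  then show ?thesis using arity_pos[of R] by (auto simp: sample_def)
next
  case (Suc k)
  have "frame \<Sigma> k (sample \<omega>) = stage \<omega> k" by (simp add: stage_eq_frame)
  moreover have "rel (stage \<omega> k) R = {}" by (simp add: stage_eq_frame Suc)
  moreover have "restr (frame \<Sigma> k A) X = frame \<Sigma> k (restr A X)" for A :: "(nat, 'r) struct" and X
    by (rule struct_eqI) auto
  ultimately show ?thesis
    by (auto simp: sample_def[of \<omega>] Suc lower_def distinct_card)
       (metis sample_def)+
qed

lemma is_structure_sample: "is_structure \<Sigma> (sample \<omega>)"
  by (rule is_structureI) (auto simp: rel_sample)

lemma sample_card:
  assumes "xs \<in> rel (sample \<omega>) R"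
  shows "card (set xs) = arity \<Sigma> R" "set xs \<noteq> {}"
  using assms arity_pos[of R] by (auto simp: rel_sample distinct_card)

text \<open>Induction on X: tuples of the lower frame live on proper subsets, where the sample is
  already a model, so the lower frame is a model and the choice over it is genuine.\<close>

lemma restr_sample:
  assumes \<omega>: "\<And>B. \<omega> B \<in> exts B" and "finite X" "X \<noteq> {}"
  shows "restr (sample \<omega>) X = \<omega> (lower (sample \<omega>) X) \<and> model \<Sigma> \<Phi> (restr (sample \<omega>) X)"
  using assms(2,3)
proof (induction X rule: finite_psubset_induct)
  case (psubset X)
  let ?S = "sample \<omega>"
  let ?L = "lower ?S X"
  have cX: "card X > 0" using psubset by (simp add: card_gt_0_iff)
  have mL: "model \<Sigma> \<Phi> ?L"
  proof (rule modelI_tuples[where 'b = nat])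
    show "is_structure \<Sigma> ?L"
      unfolding lower_def by (intro is_structure_frame is_structure_restr is_structure_sample)
    fix R xs assume "xs \<in> rel ?L R"
    then have xs: "xs \<in> rel ?S R" "set xs \<subseteq> X" "arity \<Sigma> R \<le> card X - 1"
      by (auto simp: lower_def split: if_splits)
    note c = sample_card[OF xs(1)]
    have "set xs \<subset> X" using c xs cX by auto
    then have m: "model \<Sigma> \<Phi> (restr ?S (set xs))" using psubset.IH c by blast
    have "arity \<Sigma> Q \<le> card X - 1" if "ys \<in> rel ?S Q" "set ys \<subseteq> set xs" for ys Q
      using sample_card(1)[OF that(1)] card_mono[OF _ that(2)] c(1) xs(3) by auto
    then have "embedding \<Sigma> id (restr ?L (set xs)) (restr ?S (set xs))"
      using xs(2) by (auto simp: embedding_def lower_def in_lists_conv_set subset_iff)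
    then show "\<exists>(B :: (nat, 'r) struct) f. model \<Sigma> \<Phi> B \<and> embedding \<Sigma> f (restr ?L (set xs)) B"
      using m by blast
  qed
  have fL: "frame \<Sigma> (card X - 1) ?L = ?L" by (rule struct_eqI) (auto simp: lower_def)
  let ?D = "\<omega> ?L"
  \<comment> \<open>As \<open>?L\<close> is in \<open>K\<close> and is its own lower frame, even the
    element inserted in \<open>exts ?L\<close> is a legitimate choice: no new relations.\<close>
  have "?D \<in> K \<and> universe ?D = X \<and> frame \<Sigma> (card X - 1) ?D = ?L"
    using \<omega>[of ?L] mL fL psubset.hyps by (auto simp: exts_def local_class_iff)
  then have D: "model \<Sigma> \<Phi> ?D" "universe ?D = X" "frame \<Sigma> (card X - 1) ?D = ?L"
    by (auto simp: local_class_iff)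
  have "restr ?S X = ?D"
  proof (rule struct_eqI)
    fix R
    consider "arity \<Sigma> R \<le> card X - 1" | "arity \<Sigma> R = card X" | "arity \<Sigma> R > card X" by linarith
    then show "rel (restr ?S X) R = rel ?D R"
    proof cases
      case 1
      then show ?thesis using arg_cong[OF D(3), of "\<lambda>A. rel A R"] by (simp add: lower_def)
    next
      case 2
      have full: "set xs = X" if "set xs \<subseteq> X" "card (set xs) = arity \<Sigma> R" for xs
        using that 2 psubset.hyps by (simp add: card_subset_eq)
      show ?thesis
      proof (intro set_eqI iffI)
        fix xs assume xs: "xs \<in> rel (restr ?S X) R"
        then have "set xs = X" using full[of xs] sample_card[of xs \<omega> R] by auto
        then show "xs \<in> rel ?D R" using xs rel_sample[of xs \<omega> R] by auto
      next
        fix xs assume xs: "xs \<in> rel ?D R"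
        note s = is_structureD[OF model_structure[OF D(1)] xs]
        have "set xs = X" using full[of xs] model_card[OF D(1) xs] s D(2) by auto
        then show "xs \<in> rel (restr ?S X) R"
          using xs s model_distinct[OF D(1) xs] by (auto simp: rel_sample[of xs])
      qed
    next
      case 3
      have "xs \<notin> rel ?D R" for xs
        using model_card_le[OF D(1), of xs R X] is_structureD(3)[OF model_structure[OF D(1)], of xs R]
          psubset.hyps D(2) 3 by auto
      moreover have "xs \<notin> rel (restr ?S X) R" for xs
        using sample_card(1)[of xs \<omega> R] card_mono[OF psubset.hyps, of "set xs"] 3
        by (auto simp: subset_iff)
      ultimately show ?thesis by blast
    qed
  qed (simp add: D)
  then show ?case using D(1) by simp
qed

lemma sample_in_K_inf:
  assumes "\<And>B. \<omega> B \<in> exts B"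
  shows "sample \<omega> \<in> K_inf"
proof -
  have "model \<Sigma> \<Phi> (sample \<omega>)"
  proof (rule modelI_tuples[where 'b = nat, OF is_structure_sample])
    fix R xs assume "xs \<in> rel (sample \<omega>) R"
    then have "model \<Sigma> \<Phi> (restr (sample \<omega>) (set xs))"
      using restr_sample[OF assms] sample_card(2) by blast
    moreover have "embedding \<Sigma> id (restr (sample \<omega>) (set xs)) (restr (sample \<omega>) (set xs))"
      by (simp add: embedding_def)
    ultimately show "\<exists>(B :: (nat, 'r) struct) f. model \<Sigma> \<Phi> B \<and> embedding \<Sigma> f (restr (sample \<omega>) (set xs)) B"
      by blast
  qed
  then show ?thesis by (simp add: local_class_inf_iff)
qed

lemma restr_empty:
  assumes "model \<Sigma> \<Phi> A"
  shows "restr A {} = Struct {} (\<lambda>_. {})"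
proof (rule struct_eqI)
  fix R
  have "[] \<notin> rel A R"
    using model_card[OF assms, of "[]" R] is_structureD(1)[OF model_structure[OF assms], of "[]" R]
      arity_pos[of R] by auto
  then show "rel (restr A {}) R = rel (Struct {} (\<lambda>_. {})) R" by auto
qed simp

text \<open>The condition uses the coordinate named by A, which is fixed, whereas the sample reads
  the one named by its own lower frame. By induction both have the same lower frame, so the names
  coincide. The first alternative in \<open>step\<close> admits sets where agreement is known
  already.\<close>

lemma sample_agrees:
  assumes \<omega>: "\<And>B. \<omega> B \<in> exts B" and A: "model \<Sigma> \<Phi> A" "finite X" "X \<subseteq> universe A"
    and step: "\<And>Z. Z \<subseteq> X \<Longrightarrow> Z \<noteq> {} \<Longrightarrow> card Z \<le> k \<Longrightarrow>
      restr (sample \<omega>) Z = restr A Z \<or> \<omega> (lower A Z) = restr A Z"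
    and Z: "Z \<subseteq> X" "card Z \<le> k"
  shows "restr (sample \<omega>) Z = restr A Z"
proof -
  have "finite Z" using Z A finite_subset by blast
  then show ?thesis using Z
  proof (induction Z rule: finite_psubset_induct)
    case (psubset Z)
    have mS: "model \<Sigma> \<Phi> (sample \<omega>)" using sample_in_K_inf[OF \<omega>] by (simp add: local_class_inf_iff)
    show ?case
    proof (cases "Z = {}")
      case True
      then show ?thesis using restr_empty[OF mS] restr_empty[OF A(1)] by simp
    next
      case False
      then have "card Z > 0" using psubset.hyps by (simp add: card_gt_0_iff)
      have "restr (sample \<omega>) Y = restr A Y" if "Y \<subseteq> Z" "card Y \<le> card Z - 1" for Y
      proof (rule psubset.IH)
        show "Y \<subset> Z" using that \<open>card Z > 0\<close> by auto
        show "Y \<subseteq> X" "card Y \<le> k" using that psubset.prems by auto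
      qed
      then have "lower (sample \<omega>) Z = lower A Z"
        unfolding lower_def using A psubset.prems mS by (subst frame_restr_eq_iff) auto
      moreover have "restr (sample \<omega>) Z = \<omega> (lower (sample \<omega>) Z)"
        using restr_sample[OF \<omega>] psubset.hyps False by blast
      ultimately show ?thesis using step[of Z] False psubset.prems by auto
    qed
  qed
qed

lemma sample_in_O_iff:
  assumes \<omega>: "\<And>B. \<omega> B \<in> exts B" and A: "A \<in> K"
  shows "sample \<omega> \<in> O_inf \<Sigma> \<Phi> A k \<longleftrightarrow>
    (\<forall>Z \<in> {Z. Z \<subseteq> universe A \<and> Z \<noteq> {} \<and> card Z \<le> k}. \<omega> (lower A Z) = restr A Z)"
proof -
  have mS: "model \<Sigma> \<Phi> (sample \<omega>)" using sample_in_K_inf[OF \<omega>] by (simp add: local_class_inf_iff)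
  have mA: "model \<Sigma> \<Phi> A" and fin: "finite (universe A)" using A by (auto simp: local_class_iff)
  have "sample \<omega> \<in> O_inf \<Sigma> \<Phi> A k \<longleftrightarrow>
      frame \<Sigma> k (restr (sample \<omega>) (universe A)) = frame \<Sigma> k (restr A (universe A))"
    using sample_in_K_inf[OF \<omega>] restr_universe[OF model_structure[OF mA] subset_refl]
    by (simp add: O_inf_def)
  also have "\<dots> \<longleftrightarrow> (\<forall>Z \<subseteq> universe A. finite Z \<longrightarrow> card Z \<le> k \<longrightarrow> restr (sample \<omega>) Z = restr A Z)"
    using mS mA by (intro frame_restr_eq_iff) auto
  also have "\<dots> \<longleftrightarrow> (\<forall>Z \<in> {Z. Z \<subseteq> universe A \<and> Z \<noteq> {} \<and> card Z \<le> k}. \<omega> (lower A Z) = restr A Z)"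
  proof (intro iffI ballI allI impI)
    fix Z assume *: "\<forall>Z \<subseteq> universe A. finite Z \<longrightarrow> card Z \<le> k \<longrightarrow> restr (sample \<omega>) Z = restr A Z"
      and Z: "Z \<in> {Z. Z \<subseteq> universe A \<and> Z \<noteq> {} \<and> card Z \<le> k}"
    have finZ: "finite Z" using Z fin finite_subset by blast
    have "restr (sample \<omega>) Z = restr A Z" using * Z finZ by blast
    moreover from this have "lower (sample \<omega>) Z = lower A Z" by (simp add: lower_def)
    ultimately show "\<omega> (lower A Z) = restr A Z" using restr_sample[OF \<omega> finZ] Z by auto
  next
    fix Z assume *: "\<forall>Z \<in> {Z. Z \<subseteq> universe A \<and> Z \<noteq> {} \<and> card Z \<le> k}. \<omega> (lower A Z) = restr A Z"
      and Z: "Z \<subseteq> universe A" "card Z \<le> k"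
    show "restr (sample \<omega>) Z = restr A Z"
      by (rule sample_agrees[OF \<omega> mA fin subset_refl _ Z]) (use * in auto)
  qed
  finally show ?thesis .
qed

section \<open>The product probability space and the probabilities of basic sets\<close>

definition choices :: "((nat, 'r) struct \<Rightarrow> (nat, 'r) struct) measure" where
  "choices = (\<Pi>\<^sub>M B \<in> UNIV. uniform_count_measure (exts B))"

sublocale exts: prob_space "uniform_count_measure (exts B)" for B
  using finite_exts card_exts_pos[of B] by (intro prob_space_uniform_count_measure) auto

sublocale ch: product_prob_space "\<lambda>B. uniform_count_measure (exts B)" UNIV
  by unfold_locales

sublocale choices: prob_space choices
  unfolding choices_def by (rule ch.prob_space_axioms)

lemma in_space_choices: "\<omega> \<in> space choices \<longleftrightarrow> (\<forall>B. \<omega> B \<in> exts B)"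
  by (auto simp: choices_def space_PiM PiE_iff space_uniform_count_measure)

text \<open>Injectivity of \<open>g\<close> ensures that different constraints fall on different
  coordinates, so their probabilities multiply.\<close>

lemma cylinder:
  assumes T: "finite T" "inj_on g T" and c: "\<And>t. t \<in> T \<Longrightarrow> c t \<in> exts (g t)"
  shows "{\<omega> \<in> space choices. \<forall>t \<in> T. \<omega> (g t) = c t} \<in> sets choices" (is "?C \<in> _")
    and "measure choices {\<omega> \<in> space choices. \<forall>t \<in> T. \<omega> (g t) = c t} =
      (\<Prod>t \<in> T. 1 / real (card (exts (g t))))"
proof -
  define X where "X B = {c (inv_into T g B)}" for B
  have X: "X (g t) = {c t}" if "t \<in> T" for t using that T by (simp add: X_def)
  have C: "?C = prod_emb UNIV (\<lambda>B. uniform_count_measure (exts B)) (g ` T) (Pi\<^sub>E (g ` T) X)"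
    using X by (auto simp: prod_emb_def choices_def space_PiM PiE_iff)
  have XS: "X B \<in> sets (uniform_count_measure (exts B))" if "B \<in> g ` T" for B
    using that X c by (auto simp: sets_uniform_count_measure)
  show "?C \<in> sets choices"
    unfolding C unfolding choices_def using T(1) XS by (intro sets_PiM_I) auto
  have "measure choices ?C = (\<Prod>B \<in> g ` T. measure (uniform_count_measure (exts B)) (X B))"
    unfolding C unfolding choices_def using T(1) XS by (intro ch.measure_PiM_emb) auto
  also have "\<dots> = (\<Prod>t \<in> T. measure (uniform_count_measure (exts (g t))) {c t})"
    using T(2) X by (simp add: prod.reindex)
  also have "\<dots> = (\<Prod>t \<in> T. 1 / real (card (exts (g t))))"
    using c finite_exts by (intro prod.cong) (auto simp: measure_uniform_count_measure)
  finally show "measure choices ?C = (\<Prod>t \<in> T. 1 / real (card (exts (g t))))" .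
qed

lemma inj_on_lower: "inj_on (lower A) {Z. Z \<subseteq> universe A}"
proof (rule inj_onI)
  fix X Y assume *: "X \<in> {Z. Z \<subseteq> universe A}" "Y \<in> {Z. Z \<subseteq> universe A}" "lower A X = lower A Y"
  from arg_cong[OF *(3), of universe] show "X = Y" using *(1,2) by auto
qed

lemma sample_in_O:
  assumes A: "A \<in> K"
  shows "{\<omega> \<in> space choices. sample \<omega> \<in> O_inf \<Sigma> \<Phi> A k} \<in> sets choices"
    and "measure choices {\<omega> \<in> space choices. sample \<omega> \<in> O_inf \<Sigma> \<Phi> A k} =
      (\<Prod>Z | Z \<subseteq> universe A \<and> Z \<noteq> {} \<and> card Z \<le> k. 1 / real (card (exts (lower A Z))))"
proof -
  have mA: "model \<Sigma> \<Phi> A" and fin: "finite (universe A)" using A by (auto simp: local_class_iff)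
  let ?T = "{Z. Z \<subseteq> universe A \<and> Z \<noteq> {} \<and> card Z \<le> k}"
  have eq: "{\<omega> \<in> space choices. sample \<omega> \<in> O_inf \<Sigma> \<Phi> A k} =
      {\<omega> \<in> space choices. \<forall>Z \<in> ?T. \<omega> (lower A Z) = restr A Z}"
    using sample_in_O_iff[OF _ A] by (intro Collect_cong conj_cong refl) (simp add: in_space_choices)
  have T: "finite ?T" using fin by (rule_tac finite_subset[of _ "Pow (universe A)"]) auto
  have inj: "inj_on (lower A) ?T" by (rule inj_on_subset[OF inj_on_lower]) auto
  have c: "restr A Z \<in> exts (lower A Z)" if "Z \<in> ?T" for Z
    using that fin by (intro restr_in_exts mA) (auto intro: finite_subset)
  show "{\<omega> \<in> space choices. sample \<omega> \<in> O_inf \<Sigma> \<Phi> A k} \<in> sets choices"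
    unfolding eq by (rule cylinder(1)[OF T inj c])
  show "measure choices {\<omega> \<in> space choices. sample \<omega> \<in> O_inf \<Sigma> \<Phi> A k} =
      (\<Prod>Z | Z \<subseteq> universe A \<and> Z \<noteq> {} \<and> card Z \<le> k. 1 / real (card (exts (lower A Z))))"
    unfolding eq by (rule cylinder(2)[OF T inj c])
qed

text \<open>A set of at most \<open>Suc k\<close> points consults relations of arity at most k only.
  Hence the probability at level \<open>Suc k\<close> depends on the k-frame alone, which makes the
  frames above it equally likely.\<close>

lemma lower_cong_frame:
  assumes "frame \<Sigma> k A = frame \<Sigma> k B" "card Z \<le> Suc k"
  shows "lower A Z = lower B Z"
proof (rule struct_eqI)
  have "universe (frame \<Sigma> k A) = universe (frame \<Sigma> k B)" by (simp only: assms)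
  then show "universe (lower A Z) = universe (lower B Z)" by simp
  fix R
  have "rel (frame \<Sigma> k A) R = rel (frame \<Sigma> k B) R" by (simp only: assms)
  then show "rel (lower A Z) R = rel (lower B Z) R"
    using assms(2) by (auto simp: lower_def split: if_splits)
qed

text \<open>The \<open>(k + 1)\<close>-frames over a given \<open>k\<close>-frame are equally likely and exhaust it, which determines
  their number without counting them.\<close>

lemma prob_sample_in_O:
  assumes "A \<in> K"
  shows "measure choices {\<omega> \<in> space choices. sample \<omega> \<in> O_inf \<Sigma> \<Phi> A k} = frame_weight \<Sigma> \<Phi> A k"
proof (induction k)
  case 0
  have fin: "finite (universe A)" using assms by (auto simp: local_class_iff)
  have e: "{Z. Z \<subseteq> universe A \<and> Z \<noteq> {} \<and> card Z \<le> 0} = {}"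
    using fin by (auto dest: finite_subset)
  show ?case unfolding sample_in_O(2)[OF assms] e by simp
next
  case (Suc k)
  have fin: "finite (universe A)" using assms by (auto simp: local_class_iff)
  let ?O = "\<lambda>A k. {\<omega> \<in> space choices. sample \<omega> \<in> O_inf \<Sigma> \<Phi> A k}"
  let ?w = "\<lambda>A k. \<Prod>Z | Z \<subseteq> universe A \<and> Z \<noteq> {} \<and> card Z \<le> k. 1 / real (card (exts (lower A Z)))"
  let ?T = "{frame \<Sigma> (Suc k) T | T. T \<in> K \<and> universe T = universe A \<and> frame \<Sigma> k T = frame \<Sigma> k A}"
  have ff: "frame \<Sigma> i (frame \<Sigma> j B) = frame \<Sigma> (min i j) B" for i j and B :: "(nat, 'r) struct"
    by (rule struct_eqI) auto
  have T: "B \<in> K \<and> universe B = universe A \<and> frame \<Sigma> k B = frame \<Sigma> k A \<and> frame \<Sigma> (Suc k) B = B"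
    if "B \<in> ?T" for B
  proof -
    from that obtain C where C: "B = frame \<Sigma> (Suc k) C" "C \<in> K" "universe C = universe A"
      "frame \<Sigma> k C = frame \<Sigma> k A" by blast
    then show ?thesis using model_frame[of C] by (simp add: ff local_class_iff)
  qed
  have "?T \<subseteq> {B. model \<Sigma> \<Phi> B \<and> universe B = universe A}"
  proof
    fix B assume "B \<in> ?T"
    from T[OF this] show "B \<in> {B. model \<Sigma> \<Phi> B \<and> universe B = universe A}"
      by (simp add: local_class_iff)
  qed
  then have finT: "finite ?T" using models_on_finite(1)[OF fin] finite_subset by blast
  \<comment> \<open>The event at level k splits according to the \<open>Suc k\<close>-frame that the
    sample has on the universe of A.\<close>
  have OT: "?O A k = (\<Union>B \<in> ?T. ?O B (Suc k))"
  proof (intro set_eqI iffI)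
    fix \<omega> assume \<omega>: "\<omega> \<in> ?O A k"
    let ?C = "restr (sample \<omega>) (universe A)"
    have "model \<Sigma> \<Phi> (sample \<omega>)" and s: "sample \<omega> \<in> K_inf" "frame \<Sigma> k ?C = frame \<Sigma> k A"
      using \<omega> by (auto simp: O_inf_def local_class_inf_iff)
    then have "?C \<in> K" using fin by (auto simp: local_class_iff intro: model_restr)
    with s have "frame \<Sigma> (Suc k) ?C \<in> ?T" by force
    moreover have "\<omega> \<in> ?O (frame \<Sigma> (Suc k) ?C) (Suc k)"
      using \<omega> s by (auto simp: O_inf_def ff)
    ultimately show "\<omega> \<in> (\<Union>B \<in> ?T. ?O B (Suc k))" by blast
  next
    fix \<omega> assume "\<omega> \<in> (\<Union>B \<in> ?T. ?O B (Suc k))"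
    then obtain B where B: "B \<in> ?T" and \<omega>: "\<omega> \<in> ?O B (Suc k)" by blast
    have "frame \<Sigma> (Suc k) (restr (sample \<omega>) (universe A)) = frame \<Sigma> (Suc k) B"
      using \<omega> T[OF B] by (auto simp: O_inf_def)
    then have "frame \<Sigma> k (frame \<Sigma> (Suc k) (restr (sample \<omega>) (universe A))) = frame \<Sigma> k (frame \<Sigma> (Suc k) B)"
      by simp
    then have "frame \<Sigma> k (restr (sample \<omega>) (universe A)) = frame \<Sigma> k A"
      unfolding ff using T[OF B] by simp
    then show "\<omega> \<in> ?O A k" using \<omega> by (auto simp: O_inf_def)
  qed
  have disj: "disjoint_family_on (\<lambda>B. ?O B (Suc k)) ?T"
    unfolding disjoint_family_on_def
  proof (intro ballI impI)
    fix B C assume BC: "B \<in> ?T" "C \<in> ?T" "B \<noteq> C"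
    have "B = C" if "\<omega> \<in> ?O B (Suc k)" "\<omega> \<in> ?O C (Suc k)" for \<omega>
    proof -
      have "frame \<Sigma> (Suc k) (restr (sample \<omega>) (universe A)) = frame \<Sigma> (Suc k) B"
        "frame \<Sigma> (Suc k) (restr (sample \<omega>) (universe A)) = frame \<Sigma> (Suc k) C"
        using that T[OF BC(1)] T[OF BC(2)] by (auto simp: O_inf_def)
      then show ?thesis using T[OF BC(1)] T[OF BC(2)] by simp
    qed
    then show "?O B (Suc k) \<inter> ?O C (Suc k) = {}" using BC(3) by blast
  qed
  have w: "?w B (Suc k) = ?w A (Suc k)" if "B \<in> ?T" for B
    using T[OF that] lower_cong_frame[of k B A] by (intro prod.cong) auto
  have "?w A k = measure choices (?O A k)" by (simp add: sample_in_O(2)[OF assms])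
  also have "\<dots> = (\<Sum>B \<in> ?T. measure choices (?O B (Suc k)))"
    unfolding OT
  proof (rule choices.finite_measure_finite_Union[OF finT _ disj])
    show "(\<lambda>B. ?O B (Suc k)) ` ?T \<subseteq> sets choices"
      by (rule image_subsetI, rule sample_in_O(1)) (use T in blast)
  qed
  also have "\<dots> = (\<Sum>B \<in> ?T. ?w A (Suc k))"
  proof (intro sum.cong refl)
    fix B assume B: "B \<in> ?T"
    then have "B \<in> K" using T by blast
    from sample_in_O(2)[OF this] w[OF B] show "measure choices (?O B (Suc k)) = ?w A (Suc k)"
      by (rule trans)
  qed
  also have "\<dots> = real (num_frames \<Sigma> \<Phi> A k) * ?w A (Suc k)"
    by (simp add: num_frames_def)
  finally have eq: "?w A k = real (num_frames \<Sigma> \<Phi> A k) * ?w A (Suc k)" .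
  \<comment> \<open>Positivity rules out \<open>num_frames\<close> being 0, so the division in
    \<open>frame_weight\<close> is a true one.\<close>
  have "?w A k > 0" using card_exts_pos by (intro prod_pos) auto
  moreover have "y = x / real n" if "0 < x" "x = real n * y" for x y :: real and n
    using that by (cases "n = 0") auto
  ultimately have "?w A (Suc k) = ?w A k / real (num_frames \<Sigma> \<Phi> A k)" using eq by blast
  then show ?case using Suc.IH unfolding sample_in_O(2)[OF assms] by simp
qed

section \<open>The law of the sample is the frame-wise uniform measure\<close>

abbreviation "cyl_gen \<equiv> (\<lambda>(A, k). O_inf \<Sigma> \<Phi> A k) ` (K \<times> UNIV)"

lemma cyl_gen_Pow: "cyl_gen \<subseteq> Pow K_inf"
  by (auto simp: O_inf_def)

lemma measurable_sample: "sample \<in> measurable choices (sigma K_inf cyl_gen)"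
proof (rule measurable_measure_of[OF cyl_gen_Pow])
  show "sample \<in> space choices \<rightarrow> K_inf"
    using sample_in_K_inf by (auto simp: in_space_choices)
  fix X assume "X \<in> cyl_gen"
  then obtain A k where "A \<in> K" "X = O_inf \<Sigma> \<Phi> A k" by auto
  then show "sample -` X \<inter> space choices \<in> sets choices"
    using sample_in_O(1)[of A k] by (simp add: vimage_def Int_def conj_commute)
qed

lemma in_O_iff:
  assumes "A \<in> K" "card (universe A) \<le> k"
  shows "S \<in> O_inf \<Sigma> \<Phi> A k \<longleftrightarrow> S \<in> K_inf \<and> restr S (universe A) = A"
proof -
  have A: "model \<Sigma> \<Phi> A" "finite (universe A)" using assms by (auto simp: local_class_iff)
  have "frame \<Sigma> k A = A" using frame_card_eq A assms by blast
  moreover have "frame \<Sigma> k (restr S (universe A)) = restr S (universe A)" if "S \<in> K_inf"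
    using that A assms by (intro frame_card_eq model_restr) (auto simp: local_class_inf_iff)
  ultimately show ?thesis by (auto simp: O_inf_def)
qed

text \<open>Intersections of basic sets need not be basic. On initial segments, with level n equal
  to the number of points, the whole structure is prescribed, so two such sets are nested or
  disjoint. This is the intersection-stable generator for uniqueness of measures.\<close>

abbreviation "initial_gen \<equiv> insert {} {O_inf \<Sigma> \<Phi> A n | A n. A \<in> K \<and> universe A = {..<n}}"

lemma Int_stable_initial_gen: "Int_stable initial_gen"
proof (rule Int_stableI)
  have *: "O_inf \<Sigma> \<Phi> A m \<inter> O_inf \<Sigma> \<Phi> B n \<in> initial_gen"
    if A: "A \<in> K" "universe A = {..<m}" and B: "B \<in> K" "universe B = {..<n}" and "m \<le> n" for A B m n
  proof (cases "O_inf \<Sigma> \<Phi> A m \<inter> O_inf \<Sigma> \<Phi> B n = {}")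
    case False
    then obtain S where S: "restr S {..<m} = A" "restr S {..<n} = B"
      using in_O_iff[OF A(1), of m] in_O_iff[OF B(1), of n] A B by auto
    have rr: "restr (restr S' {..<n}) {..<m} = restr S' {..<m}" for S' :: "(nat, 'r) struct"
      using \<open>m \<le> n\<close> by (intro restr_restr) auto
    have "restr B {..<m} = A" using S rr[of S] by simp
    then have "O_inf \<Sigma> \<Phi> B n \<subseteq> O_inf \<Sigma> \<Phi> A m"
      using in_O_iff[OF A(1), of m] in_O_iff[OF B(1), of n] A B rr by fastforce
    then have "O_inf \<Sigma> \<Phi> A m \<inter> O_inf \<Sigma> \<Phi> B n = O_inf \<Sigma> \<Phi> B n" by blast
    then show ?thesis using B by auto
  qed simp
  fix X Y assume "X \<in> initial_gen" "Y \<in> initial_gen"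
  then consider "X \<inter> Y = {}"
    | A m B n where "X = O_inf \<Sigma> \<Phi> A m" "Y = O_inf \<Sigma> \<Phi> B n" "A \<in> K" "universe A = {..<m}"
        "B \<in> K" "universe B = {..<n}"
    by blast
  then show "X \<inter> Y \<in> initial_gen"
  proof cases
    case 2
    then show ?thesis using *[of A m B n] *[of B n A m] by (cases "m \<le> n") (auto simp: Int_commute)
  qed simp
qed

text \<open>A basic set splits into finitely many pieces according to the structure on an initial
  segment containing the universe of A.\<close>

lemma sigma_sets_initial_gen: "sigma_sets K_inf cyl_gen = sigma_sets K_inf initial_gen"
proof (rule sigma_sets_eqI)
  fix X assume "X \<in> initial_gen"
  then consider "X = {}" | A n where "X = O_inf \<Sigma> \<Phi> A n" "A \<in> K" by blast
  then show "X \<in> sigma_sets K_inf cyl_gen"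
    by cases (auto intro: sigma_sets.Empty sigma_sets.Basic)
next
  fix X assume "X \<in> cyl_gen"
  then obtain A k where X: "X = O_inf \<Sigma> \<Phi> A k" and A: "A \<in> K" by auto
  have "finite (universe A)" using A by (auto simp: local_class_iff)
  then obtain n where n: "universe A \<subseteq> {..<n}" using finite_nat_iff_bounded by blast
  let ?T = "{T. model \<Sigma> \<Phi> T \<and> universe T = {..<n}}"
  let ?T' = "{T \<in> ?T. frame \<Sigma> k (restr T (universe A)) = frame \<Sigma> k A}"
  have K: "T \<in> K" if "T \<in> ?T" for T using that by (auto simp: local_class_iff)
  have O: "S \<in> O_inf \<Sigma> \<Phi> T n \<longleftrightarrow> S \<in> K_inf \<and> restr S {..<n} = T" if "T \<in> ?T" for T S
    using in_O_iff[OF K[OF that], of n] that by auto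
  have rr: "restr (restr S {..<n}) (universe A) = restr S (universe A)" for S
    using n by (rule restr_restr)
  have "X = (\<Union>T \<in> ?T'. O_inf \<Sigma> \<Phi> T n)"
  proof (intro set_eqI iffI)
    fix S assume S: "S \<in> X"
    then have "S \<in> K_inf" by (auto simp: X O_inf_def)
    then have T: "restr S {..<n} \<in> ?T" by (auto simp: local_class_inf_iff intro: model_restr)
    then have "S \<in> O_inf \<Sigma> \<Phi> (restr S {..<n}) n" using O \<open>S \<in> K_inf\<close> by blast
    moreover have "restr S {..<n} \<in> ?T'" using T S by (simp add: X O_inf_def rr)
    ultimately show "S \<in> (\<Union>T \<in> ?T'. O_inf \<Sigma> \<Phi> T n)" by blast
  next
    fix S assume "S \<in> (\<Union>T \<in> ?T'. O_inf \<Sigma> \<Phi> T n)"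
    then obtain T where "T \<in> ?T'" "S \<in> O_inf \<Sigma> \<Phi> T n" by blast
    then show "S \<in> X" using O[of T S] rr[of S] by (auto simp: X O_inf_def)
  qed
  moreover have "countable ?T'" using models_on_finite(1)[of "{..<n}"]
    by (intro countable_finite) (rule finite_subset[rotated], auto)
  moreover have "O_inf \<Sigma> \<Phi> T n \<in> sigma_sets K_inf initial_gen" if "T \<in> ?T'" for T
    using that K by (intro sigma_sets.Basic) auto
  ultimately show "X \<in> sigma_sets K_inf initial_gen"
    using sigma_sets_UNION[of "(\<lambda>T. O_inf \<Sigma> \<Phi> T n) ` ?T'" K_inf initial_gen] by auto
qed

lemma framewise_uniform_measure_eq_distr:
  "framewise_uniform_measure \<Sigma> \<Phi> = distr choices (sigma K_inf cyl_gen) sample"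
    (is "?M = ?D")
proof (rule measure_eqI_generator_eq[OF Int_stable_initial_gen])
  have setsM: "sets ?M = sigma_sets K_inf cyl_gen"
    unfolding framewise_uniform_measure_def by (rule sets_extend_measure[OF cyl_gen_Pow])
  have setsD: "sets ?D = sigma_sets K_inf cyl_gen"
    using cyl_gen_Pow by (simp add: sets_measure_of)
  show "sets ?M = sigma_sets K_inf initial_gen" "sets ?D = sigma_sets K_inf initial_gen"
    unfolding setsM setsD by (rule sigma_sets_initial_gen)+
  show "initial_gen \<subseteq> Pow K_inf" by (auto simp: O_inf_def)
  have D: "emeasure ?D (O_inf \<Sigma> \<Phi> A k) = ennreal (frame_weight \<Sigma> \<Phi> A k)" if "A \<in> K" for A k
  proof -
    have "O_inf \<Sigma> \<Phi> A k \<in> sets (sigma K_inf cyl_gen)"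
      using that cyl_gen_Pow by (simp add: sets_measure_of) (blast intro: sigma_sets.Basic)
    then have "emeasure ?D (O_inf \<Sigma> \<Phi> A k) = emeasure choices (sample -` O_inf \<Sigma> \<Phi> A k \<inter> space choices)"
      by (rule emeasure_distr[OF measurable_sample])
    also have "sample -` O_inf \<Sigma> \<Phi> A k \<inter> space choices = {\<omega> \<in> space choices. sample \<omega> \<in> O_inf \<Sigma> \<Phi> A k}"
      by auto
    finally show ?thesis
      by (simp add: choices.emeasure_eq_measure prob_sample_in_O[OF that])
  qed
  \<comment> \<open>The law \<open>?D\<close> is the witness that the prescribed values extend to a
    measure.\<close>
  have M: "emeasure ?M (O_inf \<Sigma> \<Phi> A k) = ennreal (frame_weight \<Sigma> \<Phi> A k)" if "A \<in> K" for A k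
    using emeasure_extend_measure[OF framewise_uniform_measure_def[of \<Sigma> \<Phi>], of "emeasure ?D" "(A, k)"]
      D that cyl_gen_Pow emeasure_positive[of ?D] emeasure_countably_additive[of ?D]
    unfolding setsM setsD by auto
  show "emeasure ?M X = emeasure ?D X" if "X \<in> initial_gen" for X using that M D by auto
  \<comment> \<open>The empty structure makes the whole space a generator of finite measure, as
    uniqueness requires.\<close>
  let ?E = "Struct {} (\<lambda>_. {}) :: (nat, 'r) struct"
  have E: "?E \<in> K" by (auto simp: local_class_iff is_structure_def intro!: modelI_tuples[where 'b = nat])
  have O: "O_inf \<Sigma> \<Phi> ?E 0 = K_inf"
    using in_O_iff[OF E, of 0] restr_empty by (auto simp: local_class_inf_iff)
  show "range (\<lambda>_ :: nat. K_inf) \<subseteq> initial_gen"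
    using E O by (auto intro!: exI[of _ ?E] exI[of _ 0])
  show "(\<Union>i :: nat. K_inf) = K_inf" by simp
  show "emeasure ?M K_inf \<noteq> \<infinity>" using M[OF E, of 0] by (simp add: O)
qed

end

section \<open>The extension property holds almost surely\<close>

text \<open>By continuity from above the limit superior of the events has probability at least p,
  and the zero-one law leaves only the value 1.\<close>

lemma (in prob_space) indep_events_prob_ge_AE:
  assumes G: "indep_events G (UNIV :: nat set)" and p: "0 < p" "\<And>n. p \<le> prob (G n)"
  shows "AE \<omega> in M. \<exists>n. \<omega> \<in> G n"
proof -
  have ev: "G n \<in> events" for n using G by (auto simp: indep_events_def)
  let ?U = "\<lambda>n. \<Union>m\<in>{n..}. G m"
  have U: "?U n \<in> events" for n using ev by auto
  have "(\<lambda>n. prob (?U n)) \<longlonglongrightarrow> prob (\<Inter>n. ?U n)"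
  proof (rule finite_Lim_measure_decseq)
    show "range ?U \<subseteq> events" using U by blast
    show "decseq ?U" unfolding decseq_def by fastforce
  qed
  moreover have "p \<le> prob (?U n)" for n
    using p(2)[of n] finite_measure_mono[of "G n" "?U n"] U by fastforce
  ultimately have "p \<le> prob (\<Inter>n. ?U n)" by (intro LIMSEQ_le_const) auto
  then have "prob (\<Inter>n. ?U n) = 1" using borel_0_1_law[OF G] p(1) by linarith
  moreover have "(\<Inter>n. ?U n) \<in> events" using U by auto
  ultimately have "AE \<omega> in M. \<omega> \<in> (\<Inter>n. ?U n)" using prob_eq_1 by blast
  then show ?thesis by eventually_elim auto
qed

context local_theory
begin

text \<open>Given agreement on Y, a copy of B at w is realised once the choices at sets containing w
  are right; the other sets lie in Y and are settled by assumption. These are the two alternatives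
  in \<open>sample_agrees\<close>.\<close>

lemma AE_extension:
  assumes B: "B \<in> K" and z: "z \<in> universe B"
  defines "Y \<equiv> universe B - {z}"
  shows "AE \<omega> in choices. restr (sample \<omega>) Y = restr B Y \<longrightarrow>
    (\<exists>w. w \<notin> Y \<and> restr (sample \<omega>) (insert w Y) = rename (id(z := w)) B)"
proof -
  have mB: "model \<Sigma> \<Phi> B" and finB: "finite (universe B)" using B by (auto simp: local_class_iff)
  have finY: "finite Y" using finB by (simp add: Y_def)
  then obtain N where N: "Y \<subseteq> {..<N}" using finite_nat_iff_bounded by blast
  define w where "w n = N + n" for n :: nat
  have wY: "w n \<notin> Y" for n using N by (auto simp: w_def)
  have inj_w: "w m = w n \<longleftrightarrow> m = n" for m n by (simp add: w_def)
  define C where "C n = rename (id(z := w n)) B" for n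
  have UC: "universe (C n) = insert (w n) Y" for n using z by (auto simp: C_def Y_def)
  have injh: "inj_on (id(z := w n)) (universe B)" for n
    using wY[of n] by (auto simp: inj_on_def Y_def)
  have mC: "model \<Sigma> \<Phi> (C n)" for n unfolding C_def by (rule model_rename[OF mB injh])
  have CY: "restr (C n) Y = restr B Y" for n
  proof (rule struct_eqI)
    fix R
    have eq: "map (id(z := w n)) xs = xs" if "z \<notin> set xs" for xs using that by (intro map_idI) auto
    have "ys \<in> rel (C n) R \<longleftrightarrow> ys \<in> rel B R" if ys: "set ys \<subseteq> Y" for ys
    proof
      assume "ys \<in> rel (C n) R"
      then obtain xs where xs: "xs \<in> rel B R" "ys = map (id(z := w n)) xs" by (auto simp: C_def)
      have "z \<notin> set xs" using ys xs(2) wY[of n] by force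
      then show "ys \<in> rel B R" using xs eq by simp
    next
      assume y: "ys \<in> rel B R"
      have "z \<notin> set ys" using ys by (auto simp: Y_def)
      then show "ys \<in> rel (C n) R" using y eq[of ys] by (force simp: C_def)
    qed
    then show "rel (restr (C n) Y) R = rel (restr B Y) R" by (auto simp: in_lists_conv_set subset_iff)
  qed (use UC z in \<open>auto simp: Y_def\<close>)
  \<comment> \<open>The sets whose choices remain to be prescribed once the structure on Y is
    given.\<close>
  define T where "T n = {Z. w n \<in> Z \<and> Z \<subseteq> insert (w n) Y}" for n
  have T_eq: "T n = insert (w n) ` Pow Y" for n
  proof (intro set_eqI iffI)
    fix Z assume "Z \<in> T n"
    then show "Z \<in> insert (w n) ` Pow Y"
      by (intro image_eqI[of _ _ "Z - {w n}"]) (auto simp: T_def)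
  qed (auto simp: T_def)
  have finT: "finite (T n)" for n using finY by (simp add: T_eq)
  have cardT: "card (T n) \<le> 2 ^ card Y" for n
    unfolding T_eq using card_image_le[of "Pow Y" "insert (w n)"] finY by (simp add: card_Pow)
  define G where "G n = {\<omega> \<in> space choices. \<forall>Z \<in> T n. \<omega> (lower (C n) Z) = restr (C n) Z}" for n
  have c: "restr (C n) Z \<in> exts (lower (C n) Z)" if "Z \<in> T n" for n Z
    using that finY by (intro restr_in_exts mC) (auto simp: T_def UC intro: finite_subset)
  have uni: "universe (lower (C n) Z) = Z" if "Z \<in> T n" for n Z
    using that by (auto simp: T_def UC)
  have injT: "inj_on (lower (C n)) (T n)" for n
    using uni by (metis inj_onI)
  have G1: "G n \<in> sets choices" for n
    unfolding G_def by (rule cylinder(1)[OF finT injT c])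
  have G2: "measure choices (G n) = (\<Prod>Z\<in>T n. 1 / real (card (exts (lower (C n) Z))))" for n
    unfolding G_def by (rule cylinder(2)[OF finT injT c])
  have indep: "choices.indep_events G UNIV"
  proof (rule choices.indep_eventsI)
    fix J :: "nat set" assume J: "finite J" "J \<noteq> {}"
    let ?g = "\<lambda>(n, Z). lower (C n) Z" and ?c = "\<lambda>(n, Z). restr (C n) Z"
    \<comment> \<open>A set in \<open>T n\<close> contains \<open>w n\<close> and no other
      \<open>w m\<close>, so events for different n constrain disjoint families of coordinates.
      Independence follows.\<close>
    have inj: "inj_on ?g (Sigma J T)"
    proof (rule inj_onI, clarify)
      fix m X n Z assume *: "X \<in> T m" "Z \<in> T n" "lower (C m) X = lower (C n) Z"
      then have "X = Z" using uni by metis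
      moreover have "w m \<in> insert (w n) Y" using *(1,2) \<open>X = Z\<close> by (auto simp: T_def)
      ultimately show "m = n \<and> X = Z" using wY[of m] inj_w by auto
    qed
    have "(\<Inter>j\<in>J. G j) = {\<omega> \<in> space choices. \<forall>t \<in> Sigma J T. \<omega> (?g t) = ?c t}"
      using J(2) by (auto simp: G_def)
    then have "measure choices (\<Inter>j\<in>J. G j) = (\<Prod>t \<in> Sigma J T. 1 / real (card (exts (?g t))))"
      using cylinder(2)[of "Sigma J T" ?g ?c] inj J finT c by auto
    also have "\<dots> = (\<Prod>n\<in>J. \<Prod>Z\<in>T n. 1 / real (card (exts (lower (C n) Z))))"
      using J finT by (subst prod.Sigma) (auto intro!: prod.cong)
    finally show "measure choices (\<Inter>j\<in>J. G j) = (\<Prod>j\<in>J. measure choices (G j))"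
      by (simp add: G2)
  qed (use G1 in auto)
  \<comment> \<open>A bound on the number of options that is the same for all n: the sets involved
    have at most \<open>Suc (card Y)\<close> points. Summing over all sizes avoids proving
    \<open>max_structs\<close> monotone.\<close>
  define D where "D = 1 + (\<Sum>i\<le>Suc (card Y). Suc (max_structs i))"
  have D: "card (exts (lower (C n) Z)) \<le> D" if "Z \<in> T n" for n Z
  proof -
    have "finite Z" using that finY by (auto simp: T_def intro: finite_subset)
    have "card Z \<le> card (insert (w n) Y)" using that finY by (intro card_mono) (auto simp: T_def)
    also have "\<dots> \<le> Suc (card Y)" by (simp add: card_insert_le_m1)
    finally have "Suc (max_structs (card Z)) \<le> (\<Sum>i\<le>Suc (card Y). Suc (max_structs i))"
      by (intro member_le_sum) auto
    moreover have "card (exts (lower (C n) Z)) \<le> Suc (max_structs (card Z))"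
      using card_exts_le[of "lower (C n) Z"] uni[OF that] \<open>finite Z\<close> by simp
    ultimately show ?thesis by (simp add: D_def)
  qed
  have D1: "D \<ge> 1" by (simp add: D_def)
  have p: "(1 / real D) ^ (2 ^ card Y) \<le> measure choices (G n)" for n
  proof -
    have "(1 / real D) ^ (2 ^ card Y) \<le> (1 / real D) ^ card (T n)"
      using D1 cardT by (intro power_decreasing) auto
    also have "\<dots> = (\<Prod>Z\<in>T n. 1 / real D)" by simp
    also have "\<dots> \<le> measure choices (G n)"
      unfolding G2 using D card_exts_pos by (intro prod_mono) (auto simp: frac_le)
    finally show ?thesis .
  qed
  have "AE \<omega> in choices. \<exists>n. \<omega> \<in> G n"
    by (rule choices.indep_events_prob_ge_AE[OF indep _ p]) (use D1 in auto)
  then show ?thesis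
  proof eventually_elim
    case (elim \<omega>)
    then obtain n where n: "\<omega> \<in> G n" by blast
    then have \<omega>: "\<omega> B \<in> exts B" for B by (simp add: G_def in_space_choices)
    show ?case
    proof
      assume SY: "restr (sample \<omega>) Y = restr B Y"
      let ?X = "insert (w n) Y"
      have "restr (sample \<omega>) ?X = restr (C n) ?X"
      proof (rule sample_agrees[OF \<omega> mC, of ?X])
        fix Z assume Z: "Z \<subseteq> ?X"
        show "restr (sample \<omega>) Z = restr (C n) Z \<or> \<omega> (lower (C n) Z) = restr (C n) Z"
        proof (cases "w n \<in> Z")
          case True
          then show ?thesis using n Z by (auto simp: G_def T_def)
        next
          case False
          then have "Z \<subseteq> Y" using Z by auto
          then show ?thesis
            using restr_restr[of Z Y "sample \<omega>"] restr_restr[of Z Y "C n"] SY CY[of n] by simp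
        qed
      qed (use finY UC in auto)
      also have "\<dots> = C n"
        using UC by (intro restr_universe[OF model_structure[OF mC]]) auto
      finally show "\<exists>w. w \<notin> Y \<and> restr (sample \<omega>) (insert w Y) = rename (id(z := w)) B"
        unfolding C_def using wY[of n] by (intro exI[of _ "w n"] conjI)
    qed
  qed
qed

lemma AE_extension_property: "AE \<omega> in choices. extension_property (sample \<omega>)"
  unfolding extension_property_def
  by (intro AE_ball_countable[THEN iffD2] ballI AE_extension countable_K)
     (auto simp: local_class_iff intro: countable_finite)

text \<open>Needed because an almost sure statement about samples gives a value of the measure only
  on a measurable set. Quantifiers range over countable sets, and each atomic condition is a basic
  set at level \<open>card (universe A)\<close>, where the frame is the whole structure.\<close>

lemma sets_extension_property:
  "{S \<in> K_inf. extension_property S} \<in> sets (sigma K_inf cyl_gen)"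
proof -
  let ?M = "sigma K_inf cyl_gen"
  have sp: "space ?M = K_inf" using cyl_gen_Pow by (simp add: space_measure_of)
  have restr: "{S \<in> space ?M. restr S (universe A) = A} \<in> sets ?M" if A: "A \<in> K" for A
  proof -
    have "{S \<in> space ?M. restr S (universe A) = A} = O_inf \<Sigma> \<Phi> A (card (universe A))"
      using in_O_iff[OF A order_refl] unfolding sp by blast
    also have "\<dots> \<in> sigma_sets K_inf cyl_gen" using A by (intro sigma_sets.Basic) auto
    finally show ?thesis using cyl_gen_Pow by (simp add: sets_measure_of)
  qed
  have "{S \<in> space ?M. extension_property S} \<in> sets ?M"
    unfolding extension_property_def
  proof (intro sets.sets_Collect_countable_All' sets.sets_Collect_imp sets.sets_Collect_countable_Ex countable_K)
    show "countable (universe B)" for B :: "(nat, 'r) struct" by simp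
    fix B z assume B: "B \<in> K" and z: "z \<in> universe B"
    let ?Y = "universe B - {z}"
    have mB: "model \<Sigma> \<Phi> B" and finB: "finite (universe B)" using B by (auto simp: local_class_iff)
    have BY: "restr B ?Y \<in> K" using mB finB by (auto simp: local_class_iff intro: model_restr)
    have "universe (restr B ?Y) = ?Y" by auto
    then show "{S \<in> space ?M. restr S ?Y = restr B ?Y} \<in> sets ?M"
      using restr[OF BY] by simp
    fix w
    show "{S \<in> space ?M. w \<notin> ?Y \<and> restr S (insert w ?Y) = rename (id(z := w)) B} \<in> sets ?M"
    proof (cases "w \<in> ?Y")
      case False
      have "inj_on (id(z := w)) (universe B)" using False by (auto simp: inj_on_def)
      then have "rename (id(z := w)) B \<in> K"
        using model_rename[OF mB] finB by (simp add: local_class_iff)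
      moreover have "universe (rename (id(z := w)) B) = insert w ?Y" using z by auto
      ultimately show ?thesis using restr[of "rename (id(z := w)) B"] False by simp
    qed simp
  qed
  then show ?thesis by (simp only: sp)
qed

lemma framewise_uniform_measure_extension_property:
  "emeasure (framewise_uniform_measure \<Sigma> \<Phi>) {S \<in> K_inf. extension_property S} = 1"
proof -
  let ?E = "{S \<in> K_inf. extension_property S}"
  have "emeasure (framewise_uniform_measure \<Sigma> \<Phi>) ?E = emeasure choices (sample -` ?E \<inter> space choices)"
    unfolding framewise_uniform_measure_eq_distr
    by (rule emeasure_distr[OF measurable_sample sets_extension_property])
  also have "\<dots> = 1"
  proof (rule choices.emeasure_eq_1_AE)
    show "sample -` ?E \<inter> space choices \<in> sets choices"
      by (rule measurable_sets[OF measurable_sample sets_extension_property])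
    show "AE \<omega> in choices. \<omega> \<in> sample -` ?E \<inter> space choices"
      using AE_extension_property AE_space
      by eventually_elim (simp add: sample_in_K_inf in_space_choices)
  qed
  finally show ?thesis .
qed

end

text \<open>A nullary symbol could be interpreted either way in a local class, but the substructures of a
  single structure all agree on it.\<close>

lemma fraisse_limit_arity_pos:
  assumes ax: "local_axioms \<Sigma> \<Phi>" and F: "fraisse_limit \<Sigma> (local_class \<Sigma> \<Phi>) F"
    and R: "R \<in> syms \<Sigma>"
  shows "arity \<Sigma> R > 0"
proof (rule ccontr)
  assume "\<not> arity \<Sigma> R > 0"
  then have R0: "arity \<Sigma> R = 0" by simp
  \<comment> \<open>Two structures on the empty universe that differ only in the nullary R. Local
    sentences quantify over at least one variable, so both satisfy them vacuously, and F would have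
    to contain both.\<close>
  define A :: "bool \<Rightarrow> (nat, _) struct"
    where "A b = Struct {} (\<lambda>Q. if b \<and> Q = R then {[]} else {})" for b
  have "A b \<in> local_class \<Sigma> \<Phi>" for b
    unfolding local_class_def mem_Collect_eq
  proof (intro conjI ballI)
    show "is_structure \<Sigma> (A b)" using R R0 by (intro is_structureI) (auto simp: A_def split: if_splits)
    fix \<phi> assume "\<phi> \<in> \<Phi>"
    then have "wf_local \<Sigma> \<phi>" using ax by (auto simp: local_axioms_def)
    then show "sat_local \<Sigma> (A b) \<phi>" by (cases \<phi>) (auto simp: A_def)
  qed (simp add: A_def)
  then have "\<exists>X. isomorphic \<Sigma> (A b) (restr F X)" for b
    using F unfolding fraisse_limit_def by blast
  then have "\<exists>X f. embedding \<Sigma> f (A b) (restr F X)" for b unfolding isomorphic_def by blast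
  then have "[] \<in> rel (A b) R \<longleftrightarrow> [] \<in> rel F R" for b
    using embeddingD(3)[of \<Sigma> _ "A b" "restr F _" R "[]"] R R0 by fastforce
  from this[of True] this[of False] show False by (simp add: A_def)
qed

theorem theorem5p10:
  fixes \<Sigma> :: "'r signature"
    and \<Phi> :: "'r local_sentence set"
    and F :: "('a, 'r) struct"
  assumes "locally_finite \<Sigma>"
    and "local_axioms \<Sigma> \<Phi>"
    and "fraisse_limit \<Sigma> (local_class \<Sigma> \<Phi>) F"
  shows "emeasure (framewise_uniform_measure \<Sigma> \<Phi>)
           {S \<in> local_class_inf \<Sigma> \<Phi>. isomorphic \<Sigma> S F} = 1"
proof -
  interpret local_theory \<Sigma> \<Phi>
    using assms fraisse_limit_arity_pos by unfold_locales
  have "{S \<in> K_inf. isomorphic \<Sigma> S F} = {S \<in> K_inf. extension_property S}"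
    using isomorphic_limitD[OF assms(3)] extension_property_isomorphic[OF assms(3)] by blast
  then show ?thesis using framewise_uniform_measure_extension_property by simp
qed

end
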